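(* Let $T_n$ be a $2$-dimensional determinantal hypertree on $n$ vertices. For any prime $p$, \[\frac{\dim H_1(T_n,\mathbb{F}_p)}{n^2}\] converges to zero in probability as $n\to\infty$.
   Context: A $2$-dimensional simplicial complex $S$ on the vertex set $[n]=\{1,\dots,n\}$ is called a ($2$-dimensional) hypertree if (a) $S$ has complete $1$-skeleton (all vertices and all edges of the complete graph on $[n]$ are in $S$); (b) the number of triangular faces of $S$ is $\binom{n-1}{2}$; (c) the homology group $H_1(S,\mathbb{Z})$ is finite. By Kalai's formula, $\sum_S |H_1(S,\mathbb{Z})|^2=n^{\binom{n-2}{2}}$, where the sum is over all hypertrees $S$ on $[n]$. The ($2$-dimensional) determinantal hypertree $T_n$ on $n$ vertices is the random hypertree on $[n]$ which equals $S$ with probability $|H_1(S,\mathbb{Z})|^2/n^{\binom{n-2}{2}}$ for each hypertree $S$. The dimension is over the field $\mathbb{F}_p$ with $p$ elements. *)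

theory Defs
  imports
    "HOL-Probability.Probability"
    "HOL-Number_Theory.Residues"
    "HOL-Algebra.IntRing"
    "Jordan_Normal_Form.Missing_VectorSpace"
begin

section \<open>Abstract simplicial complexes\<close>

text \<open>The empty simplex is not a member of a complex.\<close>

definition simplicial_complex_on :: "nat set \<Rightarrow> nat set set \<Rightarrow> bool" where
  "simplicial_complex_on V S \<longleftrightarrow>
     (\<forall>\<sigma>\<in>S. \<sigma> \<noteq> {} \<and> finite \<sigma> \<and> \<sigma> \<subseteq> V) \<and>
     (\<forall>\<sigma>\<in>S. \<forall>\<tau>. \<tau> \<noteq> {} \<and> \<tau> \<subseteq> \<sigma> \<longrightarrow> \<tau> \<in> S)"

definition faces :: "nat set set \<Rightarrow> nat \<Rightarrow> nat set set" where
  "faces S k = {\<sigma>\<in>S. card \<sigma> = k + 1}"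


section \<open>Simplicial homology with coefficients in a commutative ring\<close>

text \<open>Simplices are oriented by the order of their vertices, so that the \<open>k\<close>-chains are the
  \<open>R\<close>-valued functions on the set of \<open>k\<close>-faces.\<close>

definition chains :: "'r ring \<Rightarrow> nat set set \<Rightarrow> nat \<Rightarrow> ('r, nat set \<Rightarrow> 'r) module" where
  "chains R S k = ring.func_space R (faces S k)"

text \<open>The boundary map from \<open>(k + 1)\<close>-chains to \<open>k\<close>-chains. In the boundary of
  \<open>\<sigma> = [v\<^sub>0 < \<dots> < v\<^bsub>k+1\<^esub>]\<close> the face \<open>\<tau> = \<sigma> - {v\<^sub>i}\<close> has the sign \<open>(-1)\<^sup>i\<close>, where \<open>i\<close> is the
  number of vertices of \<open>\<tau>\<close> below \<open>v\<^sub>i\<close>. Hence the coefficient of \<open>\<tau>\<close> in the boundary of \<open>c\<close> is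
  a signed sum over the vertices \<open>v\<close> such that \<open>\<tau> \<union> {v}\<close> is a \<open>(k + 1)\<close>-face.\<close>

definition boundary ::
    "'r ring \<Rightarrow> nat set set \<Rightarrow> nat \<Rightarrow> (nat set \<Rightarrow> 'r) \<Rightarrow> (nat set \<Rightarrow> 'r)" where
  "boundary R S k c =
     (\<lambda>\<tau>\<in>faces S k.
        finsum R
          (\<lambda>v. if even (card {u\<in>\<tau>. u < v}) then c (insert v \<tau>) else a_inv R (c (insert v \<tau>)))
          {v. v \<notin> \<tau> \<and> insert v \<tau> \<in> S})"

text \<open>The quotient of a module by a submodule. The fields \<open>mult\<close> and \<open>one\<close> carry no meaning
  for modules.\<close>

definition quotient_module :: "('r, 'm) module \<Rightarrow> 'm set \<Rightarrow> ('r, 'm set) module" where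
  "quotient_module M N =
     \<lparr>carrier = A_RCOSETS M N,
      mult = (\<lambda>_ _. N),
      one = N,
      zero = N,
      add = set_add M,
      smult = (\<lambda>r C. \<Union>x\<in>C. a_r_coset M N (smult M r x))\<rparr>"

definition cycles1 :: "'r ring \<Rightarrow> nat set set \<Rightarrow> ('r, nat set \<Rightarrow> 'r) module" where
  "cycles1 R S =
     (chains R S 1)\<lparr>carrier := a_kernel (chains R S 1) (chains R S 0) (boundary R S 0)\<rparr>"

definition boundaries1 :: "'r ring \<Rightarrow> nat set set \<Rightarrow> (nat set \<Rightarrow> 'r) set" where
  "boundaries1 R S = boundary R S 1 ` carrier (chains R S 2)"

definition H1 :: "'r ring \<Rightarrow> nat set set \<Rightarrow> ('r, (nat set \<Rightarrow> 'r) set) module" where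
  "H1 R S = quotient_module (cycles1 R S) (boundaries1 R S)"

definition dim_H1_mod :: "nat \<Rightarrow> nat set set \<Rightarrow> nat" where
  "dim_H1_mod p S =
     vectorspace.dim (residue_ring (int p)) (H1 (residue_ring (int p)) S)"


section \<open>Determinantal hypertrees\<close>

definition hypertree :: "nat \<Rightarrow> nat set set \<Rightarrow> bool" where
  "hypertree n S \<longleftrightarrow>
     simplicial_complex_on {1..n} S \<and>
     (\<forall>\<sigma>\<in>S. card \<sigma> \<le> 3) \<and>
     (\<forall>\<sigma>. \<sigma> \<subseteq> {1..n} \<and> card \<sigma> \<in> {1, 2} \<longrightarrow> \<sigma> \<in> S) \<and>
     card (faces S 2) = (n - 1) choose 2 \<and>
     finite (carrier (H1 int_ring S))"

text \<open>\<open>T\<close> is a random hypertree on \<open>{1..n}\<close>, defined on the probability space \<open>M\<close>, with the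
  determinantal distribution; that the weights sum to one is Kalai's formula.\<close>

definition determinantal_hypertree :: "nat \<Rightarrow> 'a measure \<Rightarrow> ('a \<Rightarrow> nat set set) \<Rightarrow> bool" where
  "determinantal_hypertree n M T \<longleftrightarrow>
     prob_space M \<and>
     T \<in> measurable M (count_space {S. hypertree n S}) \<and>
     (\<forall>S. hypertree n S \<longrightarrow>
        measure M {\<omega>\<in>space M. T \<omega> = S} =
          (real (card (carrier (H1 int_ring S))))\<^sup>2 / real n ^ ((n - 2) choose 2))"


section \<open>Convergence in probability to a constant\<close>

text \<open>The random variables may live on different probability spaces.\<close>

definition converges_in_probability ::
    "(nat \<Rightarrow> 'a measure) \<Rightarrow> (nat \<Rightarrow> 'a \<Rightarrow> real) \<Rightarrow> real \<Rightarrow> bool" where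
  "converges_in_probability M X c \<longleftrightarrow>
     (\<forall>\<epsilon>>0. (\<lambda>n. measure (M n) {\<omega>\<in>space (M n). \<bar>X n \<omega> - c\<bar> > \<epsilon>}) \<longlonglongrightarrow> 0)"

end

theory Submission
  imports Defs "Jordan_Normal_Form.Determinant" "HOL-Real_Asymp.Real_Asymp"
begin

text \<open>
  A first moment bound: \<open>p ^ dim H\<^sub>1(T, F\<^sub>p)\<close> is at most the number of functions \<open>f\<close> on the edges
  avoiding the vertex \<open>n\<close> (extended by zero) that are cocycles on \<open>T\<close>, that is, such that \<open>T\<close> is
  contained in the set \<open>A(f)\<close> of all triangles on which the coboundary of \<open>f\<close> vanishes. As
  \<open>|H\<^sub>1(T, Z)|\<close> is at most the absolute value of a maximal minor of the reduced boundary matrix,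
  Hadamard's inequality bounds the sum of \<open>|H\<^sub>1(S, Z)|\<^sup>2\<close> over the hypertrees \<open>S \<subseteq> A(f)\<close> by the
  product over the edges \<open>e\<close> of the degree of \<open>e\<close> in \<open>A(f)\<close>.

  The degree of \<open>e\<close> is at most \<open>n D\<^sub>e\<close>, where \<open>D\<^sub>e\<close> is the proportion of vertices \<open>z\<close> for which the
  cocycle condition on \<open>e \<union> {z}\<close> forces the actual value \<open>f(e)\<close>. For every \<open>f\<close> there is a sample of
  \<open>k\<close> vertices such that replacing the proportions \<open>D\<^sub>e\<close> by \<open>(S\<^sub>e + 1) / k\<close>, with the sample counts
  \<open>S\<^sub>e\<close>, does not decrease the product over \<open>e\<close>. Once the values of \<open>f\<close> on the at most \<open>k n\<close> edges
  at the sample are fixed, the numbers \<open>(S\<^sub>e + 1) / (k + p)\<close> on the other edges form probability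
  distributions of the independent values \<open>f(e)\<close>, so that their products sum to one. Hence the
  expectation of \<open>p ^ dim H\<^sub>1(T, F\<^sub>p)\<close> is at most \<open>n ^ (n + k) p ^ (k n) exp (p n\<^sup>2 / (2 k))\<close>, and
  Markov's inequality applies with a large constant \<open>k\<close>.
\<close>

section \<open>Entropy bound by sampling\<close>

text \<open>For \<open>a + b = 1\<close> this is the expectation of \<open>h\<close> at a binomial
  variable with \<open>k\<close> trials and success probability \<open>b\<close>. The weights stay
  unnormalised so that cardinalities can be inserted for them.\<close>

fun bernoulli_sum :: "real \<Rightarrow> real \<Rightarrow> nat \<Rightarrow> (nat \<Rightarrow> real) \<Rightarrow> real" where
  "bernoulli_sum a b 0 h = h 0"
| "bernoulli_sum a b (Suc k) h =
     a * bernoulli_sum a b k h + b * bernoulli_sum a b k (\<lambda>s. h (Suc s))"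

lemma bernoulli_sum_add:
  "bernoulli_sum a b k (\<lambda>s. f s + g s) = bernoulli_sum a b k f + bernoulli_sum a b k g"
  by (induction k arbitrary: f g) (auto simp: algebra_simps)

lemma bernoulli_sum_one: "bernoulli_sum a b k (\<lambda>_. 1) = (a + b) ^ k"
  by (induction k) (auto simp: algebra_simps)

lemma bernoulli_sum_mono:
  assumes "0 \<le> a" "0 \<le> b" "\<And>s. f s \<le> g s"
  shows "bernoulli_sum a b k f \<le> bernoulli_sum a b k g"
  using assms(3)
proof (induction k arbitrary: f g)
  case (Suc k)
  then show ?case
    using assms(1,2) by (auto intro!: add_mono mult_left_mono)
qed simp

text \<open>Marking one of the successes among \<open>Suc k\<close> trials can be done by first
  choosing its place, in \<open>Suc k\<close> ways; the other \<open>k\<close> trials remain free.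
  This is the size-biasing of the binomial distribution.\<close>

lemma bernoulli_sum_size_bias:
  "bernoulli_sum a b (Suc k) (\<lambda>s. real s * h s) =
     real (Suc k) * b * bernoulli_sum a b k (\<lambda>s. h (Suc s))"
proof (induction k arbitrary: h)
  case (Suc k)
  have shift: "(\<lambda>s. real (Suc s) * h (Suc s)) = (\<lambda>s. real s * h (Suc s) + h (Suc s))"
    by (auto simp: algebra_simps)
  have "bernoulli_sum a b (Suc (Suc k)) (\<lambda>s. real s * h s) =
      a * bernoulli_sum a b (Suc k) (\<lambda>s. real s * h s) +
      b * bernoulli_sum a b (Suc k) (\<lambda>s. real (Suc s) * h (Suc s))"
    by (rule bernoulli_sum.simps(2))
  also have "\<dots> = a * (real (Suc k) * b * bernoulli_sum a b k (\<lambda>s. h (Suc s))) +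
      b * (real (Suc k) * b * bernoulli_sum a b k (\<lambda>s. h (Suc (Suc s))) +
        bernoulli_sum a b (Suc k) (\<lambda>s. h (Suc s)))"
    unfolding shift bernoulli_sum_add Suc.IH[of h] Suc.IH[of "\<lambda>s. h (Suc s)"] ..
  also have "\<dots> = real (Suc (Suc k)) * b * bernoulli_sum a b (Suc k) (\<lambda>s. h (Suc s))"
    by (simp add: algebra_simps)
  finally show ?case .
qed simp

text \<open>A list of length \<open>k\<close> is a sample of \<open>k\<close> independent draws from
  \<open>V\<close>, and a draw succeeds when it lands in \<open>G\<close>. Splitting according to
  the head of the list gives the recursion of \<open>bernoulli_sum\<close>.\<close>

lemma sum_lists_bernoulli_sum:
  assumes "finite V" "G \<subseteq> V"
  shows "(\<Sum>zs\<in>{zs. set zs \<subseteq> V \<and> length zs = k}. h (length (filter (\<lambda>z. z \<in> G) zs))) =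
    bernoulli_sum (real (card (V - G))) (real (card G)) k h"
proof (induction k arbitrary: h)
  case 0
  have "{zs. set zs \<subseteq> V \<and> length zs = 0} = {[]}" by auto
  then show ?case by simp
next
  case (Suc k)
  let ?L = "\<lambda>k. {zs. set zs \<subseteq> V \<and> length zs = k}"
  have VG: "V = (V - G) \<union> G" using assms by auto
  have "(\<Sum>zs\<in>?L (Suc k). h (length (filter (\<lambda>z. z \<in> G) zs))) =
      (\<Sum>(zs, z)\<in>?L k \<times> V. h (length (filter (\<lambda>z. z \<in> G) (z # zs))))"
    unfolding lists_length_Suc_eq
    by (subst sum.reindex) (auto simp: inj_on_def intro!: sum.cong)
  also have "\<dots> = (\<Sum>zs\<in>?L k. \<Sum>z\<in>V. h (length (filter (\<lambda>z. z \<in> G) (z # zs))))"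
    by (simp add: sum.cartesian_product)
  also have "\<dots> = (\<Sum>zs\<in>?L k. real (card (V - G)) * h (length (filter (\<lambda>z. z \<in> G) zs)) +
      real (card G) * h (Suc (length (filter (\<lambda>z. z \<in> G) zs))))"
  proof (rule sum.cong)
    fix zs
    have "(\<Sum>z\<in>V. h (length (filter (\<lambda>z. z \<in> G) (z # zs)))) =
        (\<Sum>z\<in>V - G. h (length (filter (\<lambda>z. z \<in> G) (z # zs)))) +
        (\<Sum>z\<in>G. h (length (filter (\<lambda>z. z \<in> G) (z # zs))))"
      using assms by (intro sum.subset_diff) auto
    then show "(\<Sum>z\<in>V. h (length (filter (\<lambda>z. z \<in> G) (z # zs)))) =
        real (card (V - G)) * h (length (filter (\<lambda>z. z \<in> G) zs)) +
        real (card G) * h (Suc (length (filter (\<lambda>z. z \<in> G) zs)))"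
      by simp
  qed simp
  finally show ?case
    by (simp only: sum.distrib sum_distrib_left[symmetric] Suc.IH[of h]
      Suc.IH[of "\<lambda>s. h (Suc s)"] bernoulli_sum.simps)
qed

text \<open>The size-biased identity evaluates the mean of \<open>1 / (S + 1)\<close> for a binomial variable \<open>S\<close>
  without the Jensen loss that a bound on the mean of \<open>ln S\<close> would incur.\<close>

lemma sum_lists_inverse_Suc_le:
  assumes "finite V" "G \<subseteq> V"
  shows "(\<Sum>zs\<in>{zs. set zs \<subseteq> V \<and> length zs = k}.
      real (Suc k) * real (card G) / real (Suc (length (filter (\<lambda>z. z \<in> G) zs))))
    \<le> real (card V) ^ Suc k"
proof -
  let ?a = "real (card (V - G))" and ?b = "real (card G)"
  have card: "?a + ?b = real (card V)"
    using assms by (simp add: card_Diff_subset finite_subset card_mono)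
  have "(\<Sum>zs\<in>{zs. set zs \<subseteq> V \<and> length zs = k}.
      real (Suc k) * real (card G) / real (Suc (length (filter (\<lambda>z. z \<in> G) zs)))) =
      real (Suc k) * ?b * bernoulli_sum ?a ?b k (\<lambda>s. 1 / real (Suc s))"
    by (subst sum_lists_bernoulli_sum[OF assms, symmetric]) (simp add: sum_distrib_left)
  also have "\<dots> = bernoulli_sum ?a ?b (Suc k) (\<lambda>s. real s * (1 / real s))"
    by (rule bernoulli_sum_size_bias[symmetric])
  \<comment> \<open>Since \<open>1 / 0 = 0\<close>, the factor \<open>real s * (1 / real s)\<close>
    is \<open>0\<close> at \<open>s = 0\<close> and \<open>1\<close> elsewhere.\<close>
  also have "\<dots> \<le> bernoulli_sum ?a ?b (Suc k) (\<lambda>_. 1)"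
    by (rule bernoulli_sum_mono) auto
  finally show ?thesis unfolding bernoulli_sum_one card .
qed

text \<open>A form of the inequality between arithmetic and geometric mean, obtained from
  \<open>x <= exp (x - 1)\<close> in each factor. Over an infinite set the product is
  \<open>1\<close> by convention.\<close>

lemma prod_le_1_if_sum_le_card:
  fixes x :: "'i \<Rightarrow> real"
  assumes "\<And>i. i \<in> I \<Longrightarrow> 0 \<le> x i" "sum x I \<le> card I"
  shows "prod x I \<le> 1"
proof (cases "finite I")
  case True
  have "prod x I \<le> (\<Prod>i\<in>I. exp (x i - 1))"
    using assms(1) exp_ge_add_one_self[of "x _ - 1"] by (intro prod_mono) auto
  also have "\<dots> = exp (sum x I - card I)"
    using True by (simp add: exp_sum[symmetric] sum_subtractf)
  also have "\<dots> \<le> 1" using assms(2) by simp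
  finally show ?thesis .
qed simp

text \<open>For each \<open>e\<close> the ratio \<open>r zs e\<close> of the true proportion to the
  sampled one has mean at most one over all lists. Hence some list has ratios summing to at most
  \<open>card E\<close>, and the mean inequality bounds their product by one. Adding one to the
  sample count keeps the denominators positive.\<close>

lemma exists_sample:
  assumes "finite V" "V \<noteq> {}" "finite E" "k > 0" and G: "\<And>e. e \<in> E \<Longrightarrow> G e \<subseteq> V"
  obtains zs where "set zs \<subseteq> V" "length zs = k"
    "(\<Prod>e\<in>E. real (card (G e)) / real (card V)) \<le>
       (\<Prod>e\<in>E. real (Suc (length (filter (\<lambda>z. z \<in> G e) zs))) / real k)"
proof -
  define L where "L = {zs. set zs \<subseteq> V \<and> length zs = k}"
  define r where "r zs e = real (card (G e)) / real (card V) *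
    (real k / real (Suc (length (filter (\<lambda>z. z \<in> G e) zs))))" for zs e
  have n: "real (card V) > 0" using assms by (simp add: card_gt_0_iff)
  have L: "finite L" "card L = card V ^ k"
    unfolding L_def using assms by (auto simp: finite_lists_length_eq card_lists_length_eq)
  have r0: "0 \<le> r zs e" for zs e unfolding r_def by simp
  have mean: "(\<Sum>zs\<in>L. r zs e) \<le> real (card L)" if "e \<in> E" for e
  proof -
    have "(\<Sum>zs\<in>L. r zs e) * real (card V) = (\<Sum>zs\<in>L. real k * real (card (G e)) /
        real (Suc (length (filter (\<lambda>z. z \<in> G e) zs))))"
      unfolding r_def sum_distrib_right using n by (intro sum.cong refl) (simp del: of_nat_Suc)
    \<comment> \<open>Enlarging the factor \<open>k\<close> to \<open>Suc k\<close> gives exactly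
      the sum controlled by size-biasing.\<close>
    also have "\<dots> \<le> (\<Sum>zs\<in>L. real (Suc k) * real (card (G e)) /
        real (Suc (length (filter (\<lambda>z. z \<in> G e) zs))))"
      by (intro sum_mono divide_right_mono mult_right_mono) auto
    also have "\<dots> \<le> real (card V) ^ Suc k"
      unfolding L_def using assms(1) G[OF that] by (rule sum_lists_inverse_Suc_le)
    finally have "(\<Sum>zs\<in>L. r zs e) * real (card V) \<le> real (card L) * real (card V)"
      by (simp add: L mult.commute)
    then show ?thesis using n by simp
  qed
  have "\<exists>zs\<in>L. sum (r zs) E \<le> real (card E)"
  proof (rule ccontr)
    assume "\<not> ?thesis"
    then have "(\<Sum>zs\<in>L. real (card E)) < (\<Sum>zs\<in>L. sum (r zs) E)"
      using L n by (intro sum_strict_mono) (auto simp: card_gt_0_iff[symmetric])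
    also have "\<dots> = (\<Sum>e\<in>E. \<Sum>zs\<in>L. r zs e)" by (rule sum.swap)
    also have "\<dots> \<le> (\<Sum>e\<in>E. real (card L))" by (intro sum_mono mean)
    finally show False by simp
  qed
  then obtain zs where zs: "zs \<in> L" "sum (r zs) E \<le> real (card E)" by blast
  let ?s = "\<lambda>e. real (Suc (length (filter (\<lambda>z. z \<in> G e) zs))) / real k"
  have "(\<Prod>e\<in>E. real (card (G e)) / real (card V)) = (\<Prod>e\<in>E. r zs e * ?s e)"
    using assms(4) by (intro prod.cong) (auto simp: r_def)
  also have "\<dots> = prod (r zs) E * prod ?s E" by (rule prod.distrib)
  also have "\<dots> \<le> 1 * prod ?s E"
    using zs(2) r0 by (intro mult_right_mono prod_le_1_if_sum_le_card prod_nonneg) auto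
  finally show thesis using that[of zs] zs(1) by (auto simp: L_def)
qed

text \<open>Each entry of \<open>zs\<close> is counted for at most one \<open>a\<close>. It is
  counted for none if \<open>v z\<close> lies outside \<open>C\<close>, so equality may
  fail.\<close>

lemma sum_length_filter_eq_le:
  assumes "finite C"
  shows "(\<Sum>a\<in>C. real (length (filter (\<lambda>z. v z = a) zs))) \<le> real (length zs)"
proof (induction zs)
  case (Cons z zs)
  have "(\<Sum>a\<in>C. real (length (filter (\<lambda>z. v z = a) (z # zs)))) =
      (\<Sum>a\<in>C. (if a = v z then 1 else 0) + real (length (filter (\<lambda>z. v z = a) zs)))"
    by (intro sum.cong) auto
  also have "\<dots> \<le> 1 + real (length zs)"
    using assms Cons by (auto simp: sum.distrib)
  finally show ?case by simp
qed simp

text \<open>Group the functions \<open>f\<close> by their values on \<open>I\<close>. Within a group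
  the sampled distributions no longer depend on \<open>f\<close>, so the sum over the remaining
  coordinates factorises into total masses that are at most one. The right side counts the
  groups.\<close>

lemma sum_PiE_prod_sample_le:
  fixes val :: "('e \<Rightarrow> 'c) \<Rightarrow> 'e \<Rightarrow> 'v \<Rightarrow> 'c"
  assumes fin: "finite E" "finite C" "C \<noteq> {}" and I: "I \<subseteq> E"
    and local: "\<And>f f' z e. \<lbrakk>f \<in> E \<rightarrow>\<^sub>E C; f' \<in> E \<rightarrow>\<^sub>E C; \<And>x. x \<in> I \<Longrightarrow> f x = f' x; z \<in> set zs; e \<in> E\<rbrakk>
      \<Longrightarrow> val f e z = val f' e z"
  shows "(\<Sum>f\<in>E \<rightarrow>\<^sub>E C. \<Prod>e\<in>E. real (Suc (length (filter (\<lambda>z. val f e z = f e) zs))) /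
      real (length zs + card C)) \<le> real (card C) ^ card I"
proof -
  \<comment> \<open>Add-one smoothing of the empirical distribution of the sampled values: the extra
    \<open>card C\<close> in the denominator accounts for the ones added over all \<open>a\<close>
    in \<open>C\<close>.\<close>
  define h where "h f e a = real (Suc (length (filter (\<lambda>z. val f e z = a) zs))) /
      real (length zs + card C)" for f e a
  have C: "card C > 0" using fin by (simp add: card_gt_0_iff)
  have finI: "finite I" using I fin(1) finite_subset by blast
  have h0: "0 \<le> h f e a" for f e a unfolding h_def by simp
  have h1: "h f e a \<le> 1" for f e a
  proof -
    have "length (filter (\<lambda>z. val f e z = a) zs) \<le> length zs" by simp
    then have "Suc (length (filter (\<lambda>z. val f e z = a) zs)) \<le> length zs + card C"
      using C by linarith
    then show ?thesis unfolding h_def using C by (simp add: divide_le_eq del: of_nat_Suc)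
  qed
  have hsum: "(\<Sum>a\<in>C. h f e a) \<le> 1" for f e
  proof -
    have "(\<Sum>a\<in>C. h f e a) =
        (\<Sum>a\<in>C. 1 + real (length (filter (\<lambda>z. val f e z = a) zs))) / real (length zs + card C)"
      unfolding h_def sum_divide_distrib by simp
    also have "\<dots> \<le> 1"
      using sum_length_filter_eq_le[OF fin(2), of "val f e" zs] C
      by (simp add: divide_le_eq sum.distrib)
    finally show ?thesis .
  qed
  have fibre: "(\<Sum>f\<in>{f \<in> E \<rightarrow>\<^sub>E C. restrict f I = g}. \<Prod>e\<in>E. h f e (f e)) \<le> 1"
    (is "sum ?F ?X \<le> 1") for g
  proof (cases "?X = {}")
    case True
    then show ?thesis by (metis sum.empty zero_le_one)
  next
    case False
    then obtain f0 where f0: "f0 \<in> E \<rightarrow>\<^sub>E C" "restrict f0 I = g" by auto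
    let ?r = "\<lambda>f. restrict f (E - I)"
    have agree: "f x = f0 x" if "f \<in> ?X" "x \<in> I" for f x
      using that f0(2) by (metis (mono_tags, lifting) mem_Collect_eq restrict_apply')
    have inj: "inj_on ?r ?X"
    proof (rule inj_onI)
      fix f f' assume ff: "f \<in> ?X" "f' \<in> ?X" "?r f = ?r f'"
      have "f x = f' x" if "x \<in> E" for x
      proof (cases "x \<in> I")
        case True
        then show ?thesis using agree[OF ff(1)] agree[OF ff(2)] by simp
      next
        case False
        then show ?thesis using fun_cong[OF ff(3), of x] that by simp
      qed
      moreover have "f \<in> E \<rightarrow>\<^sub>E C" "f' \<in> E \<rightarrow>\<^sub>E C" using ff(1,2) by auto
      ultimately show "f = f'" by (intro PiE_ext) auto
    qed
    have "sum ?F ?X \<le> (\<Sum>f\<in>?X. \<Prod>e\<in>E - I. h f0 e (?r f e))"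
    proof (rule sum_mono)
      fix f assume f: "f \<in> ?X"
      have "h f e a = h f0 e a" if "e \<in> E" for e a
      proof -
        have "val f e z = val f0 e z" if "z \<in> set zs" for z
          by (rule local) (use f f0 agree that \<open>e \<in> E\<close> in auto)
        then have "filter (\<lambda>z. val f e z = a) zs = filter (\<lambda>z. val f0 e z = a) zs"
          by (intro filter_cong) auto
        then show ?thesis unfolding h_def by simp
      qed
      then have "?F f = (\<Prod>e\<in>E. h f0 e (f e))" by (intro prod.cong) auto
      also have "\<dots> = (\<Prod>e\<in>E - I. h f0 e (f e)) * (\<Prod>e\<in>I. h f0 e (f e))"
        using fin(1) I by (rule prod.subset_diff[rotated])
      \<comment> \<open>The coordinates in \<open>I\<close> are fixed within the group; their
        factors are only bounded by one.\<close>
      also have "\<dots> \<le> (\<Prod>e\<in>E - I. h f0 e (f e)) * 1"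
        using h0 h1 by (intro mult_left_mono prod_le_1 prod_nonneg) auto
      finally show "?F f \<le> (\<Prod>e\<in>E - I. h f0 e (?r f e))" by simp
    qed
    also have "\<dots> = (\<Sum>g\<in>?r ` ?X. \<Prod>e\<in>E - I. h f0 e (g e))"
      using sum.reindex[OF inj, of "\<lambda>g. \<Prod>e\<in>E - I. h f0 e (g e)"] by (simp add: o_def)
    \<comment> \<open>Further functions on \<open>E - I\<close> only add nonnegative terms, and the
      sum over all of them is a product of sums.\<close>
    also have "\<dots> \<le> (\<Sum>g\<in>(E - I) \<rightarrow>\<^sub>E C. \<Prod>e\<in>E - I. h f0 e (g e))"
      using fin h0 by (intro sum_mono2 finite_PiE prod_nonneg) auto
    also have "\<dots> = (\<Prod>e\<in>E - I. \<Sum>a\<in>C. h f0 e a)"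
      using fin by (subst prod_sum_PiE) auto
    also have "\<dots> \<le> 1"
      using hsum h0 by (intro prod_le_1) (auto intro!: sum_nonneg)
    finally show ?thesis .
  qed
  have "(\<Sum>f\<in>E \<rightarrow>\<^sub>E C. \<Prod>e\<in>E. h f e (f e)) =
      (\<Sum>g\<in>I \<rightarrow>\<^sub>E C. \<Sum>f\<in>{f \<in> E \<rightarrow>\<^sub>E C. restrict f I = g}. \<Prod>e\<in>E. h f e (f e))"
    using fin finI I by (intro sum.group[symmetric] finite_PiE) auto
  also have "\<dots> \<le> (\<Sum>g\<in>I \<rightarrow>\<^sub>E C. 1)" by (intro sum_mono fibre)
  also have "\<dots> = real (card C) ^ card I" using finI by (simp add: card_PiE)
  finally show ?thesis unfolding h_def .
qed

text \<open>The set \<open>inc z\<close> holds the coordinates on which the values at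
  \<open>z\<close> may depend. Beside the scaling \<open>card V ^ card E\<close>, the bound has
  three costs: \<open>card V ^ k\<close> for the choice of a sample, \<open>card C ^ (k * m)\<close>
  for fixing \<open>f\<close> on the coordinates at the sample, and the last factor for the
  smoothing.\<close>

lemma sum_PiE_prod_card_le:
  fixes val :: "('e \<Rightarrow> 'c) \<Rightarrow> 'e \<Rightarrow> 'v \<Rightarrow> 'c"
  assumes fin: "finite V" "V \<noteq> {}" "finite E" "finite C" "C \<noteq> {}" "k > 0"
    and inc: "\<And>z. z \<in> V \<Longrightarrow> inc z \<subseteq> E" "\<And>z. z \<in> V \<Longrightarrow> card (inc z) \<le> m"
    and local: "\<And>f f' z e. \<lbrakk>f \<in> E \<rightarrow>\<^sub>E C; f' \<in> E \<rightarrow>\<^sub>E C; z \<in> V; e \<in> E;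
        \<And>x. x \<in> inc z \<Longrightarrow> f x = f' x\<rbrakk> \<Longrightarrow> val f e z = val f' e z"
  shows "(\<Sum>f\<in>E \<rightarrow>\<^sub>E C. \<Prod>e\<in>E. real (card {z\<in>V. val f e z = f e})) \<le>
    real (card V) ^ (k + card E) * real (card C) ^ (k * m) *
      (1 + real (card C) / real k) ^ card E"
proof -
  define n q where "n = real (card V)" and "q = real (card C)"
  define L where "L = {zs. set zs \<subseteq> V \<and> length zs = k}"
  define S where "S f zs e = real (Suc (length (filter (\<lambda>z. val f e z = f e) zs)))" for f zs e
  have n: "n > 0" and q: "q \<ge> 1"
    using fin by (auto simp: n_def q_def card_gt_0_iff Suc_le_eq)
  have L: "finite L" "real (card L) = n ^ k"
    unfolding L_def n_def using fin by (auto simp: finite_lists_length_eq card_lists_length_eq)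
  have sample: "(\<Prod>e\<in>E. real (card {z\<in>V. val f e z = f e}) / n) \<le>
      (\<Sum>zs\<in>L. \<Prod>e\<in>E. S f zs e / real k)" for f
  proof -
    obtain zs where zs: "set zs \<subseteq> V" "length zs = k"
      "(\<Prod>e\<in>E. real (card {z\<in>V. val f e z = f e}) / real (card V)) \<le>
        (\<Prod>e\<in>E. real (Suc (length (filter (\<lambda>z. z \<in> {z\<in>V. val f e z = f e}) zs))) / real k)"
      by (rule exists_sample[where V = V and E = E and k = k and G = "\<lambda>e. {z\<in>V. val f e z = f e}"])
        (use fin in auto)
    have "filter (\<lambda>z. z \<in> {z\<in>V. val f e z = f e}) zs = filter (\<lambda>z. val f e z = f e) zs" for e
      using zs(1) by (intro filter_cong) auto
    then have "(\<Prod>e\<in>E. real (card {z\<in>V. val f e z = f e}) / n) \<le> (\<Prod>e\<in>E. S f zs e / real k)"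
      using zs(3) unfolding n_def S_def by simp
    \<comment> \<open>The good sample depends on \<open>f\<close>. Summing over all samples removes
      this dependence, so that the two sums can be exchanged later.\<close>
    also have "\<dots> \<le> (\<Sum>zs\<in>L. \<Prod>e\<in>E. S f zs e / real k)"
      using zs(1,2) L by (intro member_le_sum prod_nonneg) (auto simp: L_def S_def)
    finally show ?thesis .
  qed
  have fixed: "(\<Sum>f\<in>E \<rightarrow>\<^sub>E C. \<Prod>e\<in>E. S f zs e / real k) \<le>
      q ^ (k * m) * (1 + q / real k) ^ card E" if zs: "zs \<in> L" for zs
  proof -
    let ?I = "\<Union>z\<in>set zs. inc z"
    have "card ?I \<le> (\<Sum>z\<in>set zs. card (inc z))" by (rule card_UN_le) simp
    also have "\<dots> \<le> (\<Sum>z\<in>set zs. m)" using zs inc(2) by (intro sum_mono) (auto simp: L_def)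
    also have "\<dots> \<le> k * m" using zs card_length[of zs] by (auto simp: L_def)
    finally have card: "card ?I \<le> k * m" .
    \<comment> \<open>Replacing the denominator \<open>k\<close> by \<open>k + card C\<close>, which
      makes the sampled weights subprobabilities, costs this factor for each
      \<open>e\<close>.\<close>
    have "1 + q / real k = real (length zs + card C) / real k" "length zs + card C > 0"
      using zs fin by (auto simp: L_def q_def add_divide_distrib)
    then have "S f zs e / real k = S f zs e / real (length zs + card C) * (1 + q / real k)" for f e
      by (simp del: of_nat_add)
    then have "(\<Sum>f\<in>E \<rightarrow>\<^sub>E C. \<Prod>e\<in>E. S f zs e / real k) =
      (\<Sum>f\<in>E \<rightarrow>\<^sub>E C. \<Prod>e\<in>E. S f zs e / real (length zs + card C)) * (1 + q / real k) ^ card E"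
      by (simp only: prod.distrib sum_distrib_right prod_constant)
    also have "\<dots> \<le> q ^ card ?I * (1 + q / real k) ^ card E"
      unfolding S_def q_def
    proof (intro mult_right_mono sum_PiE_prod_sample_le)
      show "?I \<subseteq> E" using zs inc(1) by (auto simp: L_def)
      show "val f e z = val f' e z" if "f \<in> E \<rightarrow>\<^sub>E C" "f' \<in> E \<rightarrow>\<^sub>E C"
        "\<And>x. x \<in> ?I \<Longrightarrow> f x = f' x" "z \<in> set zs" "e \<in> E" for f f' z e
        by (rule local) (use that zs in \<open>auto simp: L_def\<close>)
    qed (use fin in auto)
    also have "\<dots> \<le> q ^ (k * m) * (1 + q / real k) ^ card E"
      using q card by (intro mult_right_mono power_increasing) auto
    finally show ?thesis .
  qed
  have "(\<Sum>f\<in>E \<rightarrow>\<^sub>E C. \<Prod>e\<in>E. real (card {z\<in>V. val f e z = f e})) =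
      n ^ card E * (\<Sum>f\<in>E \<rightarrow>\<^sub>E C. \<Prod>e\<in>E. real (card {z\<in>V. val f e z = f e}) / n)"
    using n by (simp add: sum_distrib_left prod_dividef)
  also have "\<dots> \<le> n ^ card E * (\<Sum>f\<in>E \<rightarrow>\<^sub>E C. \<Sum>zs\<in>L. \<Prod>e\<in>E. S f zs e / real k)"
    using n by (intro mult_left_mono sum_mono sample) auto
  also have "\<dots> = n ^ card E * (\<Sum>zs\<in>L. \<Sum>f\<in>E \<rightarrow>\<^sub>E C. \<Prod>e\<in>E. S f zs e / real k)"
    by (subst sum.swap) simp
  also have "\<dots> \<le> n ^ card E * (\<Sum>zs\<in>L. q ^ (k * m) * (1 + q / real k) ^ card E)"
    using n by (intro mult_left_mono sum_mono fixed) auto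
  also have "\<dots> = n ^ (k + card E) * q ^ (k * m) * (1 + q / real k) ^ card E"
    by (simp add: L power_add)
  finally show ?thesis unfolding n_def q_def .
qed

section \<open>Hadamard's inequality for sums of squared minors\<close>

definition below :: "'c::linorder \<Rightarrow> 'c set \<Rightarrow> nat" where
  "below c S = card {x\<in>S. x < c}"

text \<open>The coordinate at \<open>S\<close> of the exterior product of the listed vectors,
  expanded along the first one. For finite \<open>S\<close> it vanishes unless \<open>card S\<close>
  is the number of vectors, so a sum over a power set runs over the maximal minors.\<close>

fun wedge :: "('c::linorder \<Rightarrow> 'a::comm_ring_1) list \<Rightarrow> 'c set \<Rightarrow> 'a" where
  "wedge [] S = (if S = {} then 1 else 0)"
| "wedge (v # vs) S = (\<Sum>c\<in>S. (-1) ^ below c S * v c * wedge vs (S - {c}))"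

lemma below_insert:
  assumes "finite U" "d \<notin> U"
  shows "below c (insert d U) = below c U + (if d < c then 1 else 0)"
proof -
  have "{x \<in> insert d U. x < c} = (if d < c then insert d {x\<in>U. x < c} else {x\<in>U. x < c})"
    by auto
  then show ?thesis using assms by (simp add: below_def)
qed

lemma below_insert_self: "below c (insert c U) = below c U"
  unfolding below_def by (rule arg_cong[of _ _ card]) auto

text \<open>This is \<open>\<parallel>v \<and> w\<parallel>\<^sup>2 + \<parallel>\<iota>\<^sub>v w\<parallel>\<^sup>2 = \<parallel>v\<parallel>\<^sup>2 \<parallel>w\<parallel>\<^sup>2\<close> in coordinates: the off-diagonal terms of the
  two squares cancel because exchanging two vectors changes the sign.\<close>

lemma wedge_contraction_identity:
  fixes v :: "'c::linorder \<Rightarrow> 'a::comm_ring_1"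
  assumes "finite A"
  shows "(\<Sum>S\<in>Pow A. (\<Sum>c\<in>S. (-1) ^ below c S * v c * w (S - {c}))\<^sup>2) +
      (\<Sum>U\<in>Pow A. (\<Sum>c\<in>A - U. (-1) ^ below c U * v c * w (insert c U))\<^sup>2) =
      (\<Sum>c\<in>A. (v c)\<^sup>2) * (\<Sum>U\<in>Pow A. (w U)\<^sup>2)"
proof -
  define s :: "'c \<Rightarrow> 'c set \<Rightarrow> 'a" where "s c S = (-1) ^ below c S" for c S
  have fin: "finite S" if "S \<in> Pow A" for S using that assms finite_subset by auto
  have s2: "s c S * s c S = 1" for c S
    unfolding s_def by (simp flip: power_add mult_2)
  have square: "(\<Sum>c\<in>I. g c)\<^sup>2 = (\<Sum>c\<in>I. (g c)\<^sup>2) + (\<Sum>(c, d)\<in>{(c, d)\<in>I \<times> I. c \<noteq> d}. g c * g d)"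
    if "finite I" for I :: "'c set" and g :: "'c \<Rightarrow> 'a"
  proof -
    have "(\<Sum>c\<in>I. g c)\<^sup>2 = (\<Sum>(c, d)\<in>I \<times> I. g c * g d)"
      by (simp add: power2_eq_square sum_product sum.cartesian_product)
    also have "I \<times> I = {(c, d)\<in>I \<times> I. c \<noteq> d} \<union> (\<lambda>c. (c, c)) ` I" by auto
    also have "(\<Sum>(c, d)\<in>\<dots>. g c * g d) = (\<Sum>(c, d)\<in>{(c, d)\<in>I \<times> I. c \<noteq> d}. g c * g d) +
        (\<Sum>(c, d)\<in>(\<lambda>c. (c, c)) ` I. g c * g d)"
      using that by (intro sum.union_disjoint) (auto intro: finite_subset[of _ "I \<times> I"])
    also have "(\<Sum>(c, d)\<in>(\<lambda>c. (c, c)) ` I. g c * g d) = (\<Sum>c\<in>I. (g c)\<^sup>2)"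
      by (subst sum.reindex) (auto simp: inj_on_def power2_eq_square)
    finally show ?thesis by (simp add: add.commute)
  qed
  \<comment> \<open>\<open>X\<close> and \<open>Y\<close> collect the off-diagonal terms of the two
    families of squares; the cancellation to be shown is \<open>X + Y = 0\<close>.\<close>
  define X where "X = (\<Sum>S\<in>Pow A. \<Sum>(c, d)\<in>{(c, d)\<in>S \<times> S. c \<noteq> d}.
    (s c S * v c * w (S - {c})) * (s d S * v d * w (S - {d})))"
  define Y where "Y = (\<Sum>U\<in>Pow A. \<Sum>(c, d)\<in>{(c, d)\<in>(A - U) \<times> (A - U). c \<noteq> d}.
    (s c U * v c * w (insert c U)) * (s d U * v d * w (insert d U)))"
  have L1: "(\<Sum>S\<in>Pow A. (\<Sum>c\<in>S. s c S * v c * w (S - {c}))\<^sup>2) =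
      (\<Sum>S\<in>Pow A. \<Sum>c\<in>S. (v c)\<^sup>2 * (w (S - {c}))\<^sup>2) + X"
    unfolding X_def sum.distrib[symmetric]
    using fin by (intro sum.cong refl)
      (simp add: square power_mult_distrib power2_eq_square[of "s _ _"] s2)
  have L2: "(\<Sum>U\<in>Pow A. (\<Sum>c\<in>A - U. s c U * v c * w (insert c U))\<^sup>2) =
      (\<Sum>U\<in>Pow A. \<Sum>c\<in>A - U. (v c)\<^sup>2 * (w (insert c U))\<^sup>2) + Y"
    unfolding Y_def sum.distrib[symmetric]
    using assms by (intro sum.cong refl)
      (simp add: square power_mult_distrib power2_eq_square[of "s _ _"] s2)
  \<comment> \<open>Removing \<open>c\<close> in the first family and inserting it in the second
    brings the diagonal terms to a common set: there \<open>c\<close> runs through its complement in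
    one family and through the set itself in the other.\<close>
  have D1: "(\<Sum>S\<in>Pow A. \<Sum>c\<in>S. (v c)\<^sup>2 * (w (S - {c}))\<^sup>2) =
      (\<Sum>U\<in>Pow A. \<Sum>c\<in>A - U. (v c)\<^sup>2 * (w U)\<^sup>2)"
    using assms fin
    by (simp add: sum.Sigma del: Pow_iff,
        intro sum.reindex_bij_witness[where i = "\<lambda>(U, c). (insert c U, c)" and
          j = "\<lambda>(S, c). (S - {c}, c)"]) auto
  have D2: "(\<Sum>U\<in>Pow A. \<Sum>c\<in>A - U. (v c)\<^sup>2 * (w (insert c U))\<^sup>2) =
      (\<Sum>S\<in>Pow A. \<Sum>c\<in>S. (v c)\<^sup>2 * (w S)\<^sup>2)"
    using assms fin
    by (simp add: sum.Sigma del: Pow_iff,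
        intro sum.reindex_bij_witness[where j = "\<lambda>(U, c). (insert c U, c)" and
          i = "\<lambda>(S, c). (S - {c}, c)"]) (auto simp: insert_absorb)
  have diag: "(\<Sum>U\<in>Pow A. \<Sum>c\<in>A - U. (v c)\<^sup>2 * (w U)\<^sup>2) + (\<Sum>S\<in>Pow A. \<Sum>c\<in>S. (v c)\<^sup>2 * (w S)\<^sup>2) =
      (\<Sum>c\<in>A. (v c)\<^sup>2) * (\<Sum>U\<in>Pow A. (w U)\<^sup>2)"
    unfolding sum.distrib[symmetric] sum_distrib_left
  proof (intro sum.cong refl)
    fix U assume "U \<in> Pow A"
    then show "(\<Sum>c\<in>A - U. (v c)\<^sup>2 * (w U)\<^sup>2) + (\<Sum>c\<in>U. (v c)\<^sup>2 * (w U)\<^sup>2) =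
        (\<Sum>c\<in>A. (v c)\<^sup>2) * (w U)\<^sup>2"
      using assms by (subst sum.subset_diff[of U A, symmetric]) (auto simp: sum_distrib_right)
  qed
  have "X = (\<Sum>(S, c, d)\<in>(SIGMA S:Pow A. {(c, d)\<in>S \<times> S. c \<noteq> d}).
      (s c S * v c * w (S - {c})) * (s d S * v d * w (S - {d})))"
    unfolding X_def using assms fin
    by (subst sum.Sigma) (auto simp: case_prod_unfold intro: finite_subset[of _ "_ \<times> _"])
  also have "\<dots> = (\<Sum>(U, c, d)\<in>(SIGMA U:Pow A. {(c, d)\<in>(A - U) \<times> (A - U). c \<noteq> d}).
      - ((s c U * v c * w (insert c U)) * (s d U * v d * w (insert d U))))"
  \<comment> \<open>For \<open>U = S - {c, d}\<close> the set \<open>S - {c}\<close> is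
    \<open>insert d U\<close>, so \<open>c\<close> and \<open>d\<close> change places under the
    bijection.\<close>
  proof (rule sum.reindex_bij_witness[where j = "\<lambda>(S, c, d). (S - {c, d}, d, c)" and
        i = "\<lambda>(U, c, d). (U \<union> {c, d}, d, c)"])
    fix x assume "x \<in> (SIGMA S:Pow A. {(c, d)\<in>S \<times> S. c \<noteq> d})"
    then obtain S c d where x: "x = (S, c, d)" "S \<subseteq> A" "c \<in> S" "d \<in> S" "c \<noteq> d"
      by auto
    define U where "U = S - {c, d}"
    have U: "finite U" "c \<notin> U" "d \<notin> U" "S = insert c (insert d U)" "S - {c} = insert d U"
      "S - {d} = insert c U"
      using x assms finite_subset unfolding U_def by auto
    have "s c S = s c U * (if d < c then -1 else 1)"
      unfolding s_def U(4) below_insert_self using U by (simp add: below_insert)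
    moreover have "s d S = s d U * (if c < d then -1 else 1)"
      unfolding s_def U(4) insert_commute[of c d] below_insert_self using U
      by (simp add: below_insert)
    \<comment> \<open>Exactly one of \<open>c\<close> and \<open>d\<close> lies below the other,
      hence exactly one of the two signs flips.\<close>
    ultimately have signs: "s c S * s d S = - (s c U * s d U)"
      using x(5) by (auto simp: neq_iff)
    have "(s c S * v c * w (S - {c})) * (s d S * v d * w (S - {d})) =
        (s c S * s d S) * (v c * w (S - {c}) * v d * w (S - {d}))"
      by (simp only: mult_ac)
    also have "\<dots> = - (s d U * v d * w (insert d U) * (s c U * v c * w (insert c U)))"
      unfolding signs U(5,6) by (simp only: mult_minus_left mult_minus_right mult_ac)
    finally have "(s c S * v c * w (S - {c})) * (s d S * v d * w (S - {d})) =
        - (s d U * v d * w (insert d U) * (s c U * v c * w (insert c U)))" .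
    then show "(case (case x of (S, c, d) \<Rightarrow> (S - {c, d}, d, c)) of (U, c, d) \<Rightarrow>
        - ((s c U * v c * w (insert c U)) * (s d U * v d * w (insert d U)))) =
        (case x of (S, c, d) \<Rightarrow> (s c S * v c * w (S - {c})) * (s d S * v d * w (S - {d})))"
      unfolding x(1) U_def by simp
  qed auto
  also have "\<dots> = - Y"
    unfolding Y_def sum_negf[symmetric] using assms fin
    by (subst sum.Sigma)
      (auto simp: case_prod_unfold sum_negf intro: finite_subset[of _ "A \<times> A"])
  finally have "X + Y = 0" by simp
  then show ?thesis
    unfolding s_def[symmetric] L1 L2 D1 D2 diag[symmetric] by (simp add: algebra_simps)
qed

text \<open>By Cauchy-Binet the left side is the Gram determinant of the vectors, so this is
  Hadamard's inequality. The induction step drops the nonnegative contraction term of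
  \<open>wedge_contraction_identity\<close>.\<close>

lemma sum_wedge_square_le:
  fixes vs :: "('c::linorder \<Rightarrow> 'a::linordered_idom) list"
  assumes "finite A"
  shows "(\<Sum>S\<in>Pow A. (wedge vs S)\<^sup>2) \<le> (\<Prod>v\<leftarrow>vs. \<Sum>c\<in>A. (v c)\<^sup>2)"
proof (induction vs)
  case Nil
  have "(\<Sum>S\<in>Pow A. (wedge [] S :: 'a)\<^sup>2) = (\<Sum>S\<in>Pow A. if S = {} then 1 else 0)"
    by (intro sum.cong) auto
  then show ?case using assms by simp
next
  case (Cons v vs)
  have "(\<Sum>S\<in>Pow A. (wedge (v # vs) S)\<^sup>2) \<le> (\<Sum>c\<in>A. (v c)\<^sup>2) * (\<Sum>S\<in>Pow A. (wedge vs S)\<^sup>2)"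
    unfolding wedge_contraction_identity[OF assms, of v "wedge vs", symmetric]
    by (auto intro!: sum_nonneg)
  also have "\<dots> \<le> (\<Sum>c\<in>A. (v c)\<^sup>2) * (\<Prod>v\<leftarrow>vs. \<Sum>c\<in>A. (v c)\<^sup>2)"
    by (intro mult_left_mono Cons.IH sum_nonneg) auto
  finally show ?case by simp
qed

text \<open>Laplace expansion along the first row follows the recursion of \<open>wedge\<close>: in
  a strictly increasing list the position of an entry is the number of entries below it, so the
  cofactor signs agree.\<close>

lemma det_eq_wedge:
  fixes vs :: "('c::linorder \<Rightarrow> 'a::comm_ring_1) list"
  assumes "sorted_wrt (<) cs" "length cs = length vs"
  shows "Determinant.det (Matrix.mat (length vs) (length vs) (\<lambda>(i, j). (vs ! i) (cs ! j))) =
    wedge vs (set cs)"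
  using assms
proof (induction vs arbitrary: cs)
  case (Cons v vs)
  let ?n = "length (v # vs)"
  let ?A = "Matrix.mat ?n ?n (\<lambda>(i, j). ((v # vs) ! i) (cs ! j))"
  have dist: "distinct cs" using Cons.prems(1) by (simp add: strict_sorted_iff)
  have summand: "?A $$ (0, j) * cofactor ?A 0 j =
      (-1) ^ below (cs ! j) (set cs) * v (cs ! j) * wedge vs (set cs - {cs ! j})" if j: "j < ?n" for j
  proof -
    define ds where "ds = take j cs @ drop (Suc j) cs"
    have cs: "cs = take j cs @ cs ! j # drop (Suc j) cs"
      using j Cons.prems(2) by (simp add: id_take_nth_drop)
    have ds: "length ds = length vs" "ds ! l = cs ! (if l < j then l else Suc l)"
      if "l < length vs" for l
      using j that Cons.prems(2) by (auto simp: ds_def nth_append min_def)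
    have len: "length ds = length vs" using j Cons.prems(2) by (simp add: ds_def)
    have setds: "set ds = set cs - {cs ! j}"
    proof -
      have "distinct (take j cs @ cs ! j # drop (Suc j) cs)"
        "set cs = set (take j cs @ cs ! j # drop (Suc j) cs)"
        using cs dist by simp_all
      then show ?thesis unfolding ds_def by auto
    qed
    have "sorted_wrt (<) (take j cs @ cs ! j # drop (Suc j) cs)" using cs Cons.prems(1) by simp
    then have sorted: "sorted_wrt (<) ds"
      unfolding ds_def by (auto simp: sorted_wrt_append)
    have "{x \<in> set cs. x < cs ! j} = set (take j cs)"
    proof -
      have "sorted_wrt (<) (take j cs @ cs ! j # drop (Suc j) cs)"
        "set cs = set (take j cs @ cs ! j # drop (Suc j) cs)"
        using cs Cons.prems(1) by simp_all
      then show ?thesis by (auto simp: sorted_wrt_append)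
    qed
    then have below: "below (cs ! j) (set cs) = j"
      unfolding below_def using dist j Cons.prems(2) by (simp add: distinct_card)
    have "mat_delete ?A 0 j =
        Matrix.mat (length vs) (length vs) (\<lambda>(i, j). (vs ! i) (ds ! j))"
      using ds(2) by (intro eq_matI) (auto simp: mat_delete_def)
    then show ?thesis
      using Cons.IH[OF sorted len] j unfolding cofactor_def setds below by (simp add: mult_ac)
  qed
  have "Determinant.det ?A = (\<Sum>j<?n. ?A $$ (0, j) * cofactor ?A 0 j)"
    by (rule laplace_expansion_row) auto
  also have "\<dots> = (\<Sum>j<?n. (-1) ^ below (cs ! j) (set cs) * v (cs ! j) *
      wedge vs (set cs - {cs ! j}))"
    by (intro sum.cong refl summand) simp
  also have "\<dots> = wedge (v # vs) (set cs)"
  proof -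
    have "bij_betw (\<lambda>j. cs ! j) {..<?n} (set cs)"
      using bij_betw_nth[OF dist] Cons.prems(2) by simp
    then show ?thesis
      by (simp add: sum.reindex_bij_betw[where h = "\<lambda>j. cs ! j", symmetric] del: length_Cons)
  qed
  finally show ?case .
qed simp

section \<open>Lattice index and determinant\<close>

text \<open>An upper bound for the index of the column lattice of \<open>A\<close>. The set
  \<open>R\<close> has to meet every coset but may meet a coset several times.\<close>

definition lattice_index_le :: "int mat \<Rightarrow> nat \<Rightarrow> bool" where
  "lattice_index_le A m \<longleftrightarrow> (\<exists>R. finite R \<and> card R \<le> m \<and>
     (\<forall>v\<in>carrier_vec (dim_row A). \<exists>r\<in>R. \<exists>x\<in>carrier_vec (dim_col A). v = r + A *\<^sub>v x))"

text \<open>The column lattice of \<open>A * E\<close> is contained in that of \<open>A\<close>, so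
  the same representatives work. With elementary \<open>E\<close> this undoes column
  operations.\<close>

lemma lattice_index_le_mult_right:
  assumes "A \<in> carrier_mat n n" "E \<in> carrier_mat n n" "lattice_index_le (A * E) m"
  shows "lattice_index_le A m"
proof -
  obtain R where R: "finite R" "card R \<le> m"
    "\<And>v. v \<in> carrier_vec n \<Longrightarrow> \<exists>r\<in>R. \<exists>x\<in>carrier_vec n. v = r + (A * E) *\<^sub>v x"
    using assms unfolding lattice_index_le_def by auto
  have "\<exists>r\<in>R. \<exists>x\<in>carrier_vec n. v = r + A *\<^sub>v x" if v: "v \<in> carrier_vec n" for v
  proof -
    obtain r x where "r \<in> R" "x \<in> carrier_vec n" "v = r + (A * E) *\<^sub>v x" using R(3)[OF v] by blast
    moreover have "(A * E) *\<^sub>v x = A *\<^sub>v (E *\<^sub>v x)"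
      using assms \<open>x \<in> carrier_vec n\<close> by (intro assoc_mult_mat_vec)
    ultimately show ?thesis using assms by (metis mult_mat_vec_carrier)
  qed
  then show ?thesis using R(1,2) assms(1) unfolding lattice_index_le_def by auto
qed

text \<open>Only the first column affects the first coordinate. Dividing that coordinate by its
  entry leaves one of finitely many remainders and fixes the multiple \<open>q\<close> of the first
  column; what remains in the other coordinates is a problem for the minor.\<close>

lemma lattice_index_le_first_row:
  assumes A: "A \<in> carrier_mat (Suc n) (Suc n)"
    and row: "\<And>j. 0 < j \<Longrightarrow> j < Suc n \<Longrightarrow> A $$ (0, j) = 0" and g: "A $$ (0, 0) \<noteq> 0"
    and minor: "lattice_index_le (mat_delete A 0 0) m"
  shows "lattice_index_le A (nat \<bar>A $$ (0, 0)\<bar> * m)"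
proof -
  define g where "g = A $$ (0, 0)"
  define B where "B = mat_delete A 0 0"
  have B: "B \<in> carrier_mat n n" using A mat_delete_carrier[OF A] unfolding B_def by simp
  have Bij: "B $$ (i, j) = A $$ (Suc i, Suc j)" if "i < n" "j < n" for i j
    unfolding B_def mat_delete_def using A that by simp
  obtain R where R: "finite R" "card R \<le> m"
    "\<And>v. v \<in> carrier_vec n \<Longrightarrow> \<exists>r\<in>R. \<exists>x\<in>carrier_vec n. v = r + B *\<^sub>v x"
    using minor B unfolding lattice_index_le_def B_def[symmetric] by auto
  define R' where "R' = (\<lambda>(a, r). vCons a r) ` ({0..<\<bar>g\<bar>} \<times> R)"
  have "card R' \<le> nat \<bar>g\<bar> * card R"
    unfolding R'_def using card_image_le[of "{0..<\<bar>g\<bar>} \<times> R" "\<lambda>(a, r). vCons a r"] R(1)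
    by (simp add: card_cartesian_product)
  also have "\<dots> \<le> nat \<bar>g\<bar> * m" using R(2) by simp
  finally have card: "card R' \<le> nat \<bar>g\<bar> * m" .
  have "\<exists>r\<in>R'. \<exists>x\<in>carrier_vec (Suc n). v = r + A *\<^sub>v x" if v: "v \<in> carrier_vec (Suc n)" for v
  proof -
    define a where "a = vec_index v 0 mod \<bar>g\<bar>"
    \<comment> \<open>The factor \<open>sgn g\<close> converts the quotient by the absolute value of
      \<open>g\<close> into a multiple of \<open>g\<close> itself.\<close>
    define q where "q = sgn g * (vec_index v 0 div \<bar>g\<bar>)"
    have "g * sgn g = \<bar>g\<bar>" by (simp add: abs_sgn)
    then have "g * q = \<bar>g\<bar> * (vec_index v 0 div \<bar>g\<bar>)"
      unfolding q_def by (metis mult.assoc)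
    then have v0: "vec_index v 0 = a + g * q" by (simp add: a_def)
    define w where "w = Matrix.vec n (\<lambda>i. vec_index v (Suc i) - A $$ (Suc i, 0) * q)"
    obtain r x where rx: "r \<in> R" "x \<in> carrier_vec n" "w = r + B *\<^sub>v x"
      using R(3)[of w] vec_carrier unfolding w_def by blast
    have "a \<in> {0..<\<bar>g\<bar>}" using g by (simp add: a_def g_def)
    then have "vCons a r \<in> R'" unfolding R'_def using rx(1) by auto
    moreover have "vCons q x \<in> carrier_vec (Suc n)" using rx(2) by simp
    moreover have "v = vCons a r + A *\<^sub>v vCons q x"
    proof (rule eq_vecI)
      show "dim_vec v = dim_vec (vCons a r + A *\<^sub>v vCons q x)" using v A by simp
      fix i assume "i < dim_vec (vCons a r + A *\<^sub>v vCons q x)"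
      then have i: "i < Suc n" using A by simp
      have prod: "vec_index (A *\<^sub>v vCons q x) i =
          A $$ (i, 0) * q + (\<Sum>j<n. A $$ (i, Suc j) * vec_index x j)"
        using i A rx(2)
        by (simp add: scalar_prod_def sum.atLeast0_lessThan_Suc_shift atLeast0LessThan[symmetric]
            del: sum.op_ivl_Suc)
      show "vec_index v i = vec_index (vCons a r + A *\<^sub>v vCons q x) i"
      proof (cases i)
        case 0
        have "(\<Sum>j<n. A $$ (0, Suc j) * vec_index x j) = 0"
          using row by (intro sum.neutral) auto
        then show ?thesis using prod v0 A i by (simp add: 0 g_def)
      next
        case (Suc k)
        then have k: "k < n" using i by simp
        have "vec_index w k = vec_index r k + vec_index (B *\<^sub>v x) k"
          unfolding rx(3) using k B by simp
        also have "vec_index (B *\<^sub>v x) k = (\<Sum>j<n. A $$ (Suc k, Suc j) * vec_index x j)"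
          using k B rx(2) by (simp add: scalar_prod_def Bij atLeast0LessThan)
        finally show ?thesis using prod A i k by (simp add: Suc w_def)
      qed
    qed
    ultimately show ?thesis by blast
  qed
  then show ?thesis
    using card R(1) A unfolding lattice_index_le_def g_def[symmetric]
    by (intro exI[of _ R']) (auto simp: R'_def)
qed

text \<open>Euclid's algorithm on the first row, carried out by column operations, reduces the
  dimension.\<close>

lemma lattice_index_le_det:
  fixes A :: "int mat"
  assumes "A \<in> carrier_mat n n" "Determinant.det A \<noteq> 0"
  shows "lattice_index_le A (nat \<bar>Determinant.det A\<bar>)"
  using assms
proof (induction n arbitrary: A)
  case 0
  have "v = 0\<^sub>v 0 + A *\<^sub>v v" if "v \<in> carrier_vec 0" for v
    using that 0(1) by (intro eq_vecI) auto
  then have "\<forall>v\<in>carrier_vec 0. \<exists>r\<in>{0\<^sub>v 0}. \<exists>x\<in>carrier_vec 0. v = r + A *\<^sub>v x"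
    by blast
  then show ?case using 0 unfolding lattice_index_le_def
    by (intro exI[of _ "{0\<^sub>v 0}"]) auto
next
  case (Suc n)
  note outer = Suc.IH
  \<comment> \<open>The termination measure of Euclid's algorithm, for the inner induction at fixed
    dimension.\<close>
  define W where "W B = (\<Sum>j<Suc n. nat \<bar>B $$ (0, j)\<bar>)" for B :: "int mat"
  show ?case using Suc.prems
  proof (induction "W A" arbitrary: A rule: less_induct)
    case (less A)
    note A = less.prems(1)
    show ?case
    proof (cases "\<exists>j l. j < Suc n \<and> l < Suc n \<and> j \<noteq> l \<and> A $$ (0, j) \<noteq> 0 \<and> \<bar>A $$ (0, j)\<bar> \<le> \<bar>A $$ (0, l)\<bar>")
      case True
      then obtain j l where jl: "j < Suc n" "l < Suc n" "j \<noteq> l" "A $$ (0, j) \<noteq> 0"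
        "\<bar>A $$ (0, j)\<bar> \<le> \<bar>A $$ (0, l)\<bar>" by blast
      \<comment> \<open>The signs are chosen such that the new entry in column \<open>l\<close> has
        absolute value \<open>|A $$ (0, l)| - |A $$ (0, j)|\<close>; this is one subtractive
        Euclidean step.\<close>
      define t where "t = - sgn (A $$ (0, j)) * sgn (A $$ (0, l))"
      let ?B = "addcol t l j A"
      have B: "?B \<in> carrier_mat (Suc n) (Suc n)" using A by (auto simp: mat_addcol_def)
      have B0: "?B $$ (0, c) = (if c = l then t * A $$ (0, j) + A $$ (0, l) else A $$ (0, c))"
        if "c < Suc n" for c
        using A that by simp
      have detB: "Determinant.det ?B = Determinant.det A"
        using jl A by (intro det_addcol) auto
      have less_l: "\<bar>t * A $$ (0, j) + A $$ (0, l)\<bar> < \<bar>A $$ (0, l)\<bar>"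
        using jl(4,5) unfolding t_def by (auto simp: sgn_if abs_if split: if_splits)
      have "W ?B < W A"
        unfolding W_def
      proof (rule sum_strict_mono_ex1)
        show "\<forall>c\<in>{..<Suc n}. nat \<bar>?B $$ (0, c)\<bar> \<le> nat \<bar>A $$ (0, c)\<bar>"
          using B0 less_l by auto
        show "\<exists>c\<in>{..<Suc n}. nat \<bar>?B $$ (0, c)\<bar> < nat \<bar>A $$ (0, c)\<bar>"
          using B0[OF jl(2)] less_l jl(2) by (intro bexI[of _ l]) auto
      qed simp
      then have "lattice_index_le ?B (nat \<bar>Determinant.det A\<bar>)"
        using less.hyps B detB less.prems(2) by metis
      then show ?thesis
        unfolding addcol_mat[OF A jl(1)]
        by (rule lattice_index_le_mult_right[OF A, rotated]) simp
    next
      \<comment> \<open>Of two nonzero entries one would be at most the other in absolute value, so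
        at most one entry of the first row is nonzero.\<close>
      case False
      have "\<exists>j<Suc n. A $$ (0, j) \<noteq> 0"
      proof (rule ccontr)
        assume "\<not> ?thesis"
        then have "Determinant.det A = 0"
          by (subst laplace_expansion_row[OF A, of 0]) auto
        then show False using less.prems(2) by simp
      qed
      then obtain j where j: "j < Suc n" "A $$ (0, j) \<noteq> 0" by blast
      have other: "A $$ (0, l) = 0" if "l < Suc n" "l \<noteq> j" for l
      proof (rule ccontr)
        assume "A $$ (0, l) \<noteq> 0"
        then show False using False j that by (metis linear)
      qed
      define B where "B = (if j = 0 then A else swapcols 0 j A)"
      have B: "B \<in> carrier_mat (Suc n) (Suc n)" using A by (auto simp: B_def)
      have B0: "B $$ (0, 0) \<noteq> 0" "\<And>c. 0 < c \<Longrightarrow> c < Suc n \<Longrightarrow> B $$ (0, c) = 0"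
        using A j other by (auto simp: B_def)
      have detB: "\<bar>Determinant.det B\<bar> = \<bar>Determinant.det A\<bar>"
        using det_swapcols[of 0 "Suc n" j A] A j by (auto simp: B_def)
      have "Determinant.det B = (\<Sum>c<Suc n. B $$ (0, c) * cofactor B 0 c)"
        by (rule laplace_expansion_row[OF B]) simp
      also have "\<dots> = B $$ (0, 0) * Determinant.det (mat_delete B 0 0)"
        by (subst sum.remove[of _ 0]) (auto simp: B0(2) cofactor_def)
      finally have det: "Determinant.det B = B $$ (0, 0) * Determinant.det (mat_delete B 0 0)" .
      have "lattice_index_le (mat_delete B 0 0) (nat \<bar>Determinant.det (mat_delete B 0 0)\<bar>)"
        using mat_delete_carrier[OF B] det detB less.prems(2) by (intro outer) auto
      then have "lattice_index_le B (nat \<bar>Determinant.det A\<bar>)"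
        using lattice_index_le_first_row[OF B B0(2,1)] unfolding detB[symmetric] det
        by (simp add: abs_mult nat_mult_distrib)
      then show ?thesis
      proof (cases "j = 0")
        case False
        then show ?thesis
          using \<open>lattice_index_le B _\<close> swapcols_mat[OF A _ j(1), of 0]
          by (intro lattice_index_le_mult_right[OF A, of "swaprows_mat (Suc n) 0 j"])
            (auto simp: B_def)
      qed (simp add: B_def)
    qed
  qed
qed

section \<open>Quotient modules and linear functionals\<close>

lemma submodule_abelian_subgroup:
  assumes "submodule R N M"
  shows "abelian_subgroup N M"
proof -
  interpret submodule R N M by (rule assms)
  interpret M: module R M by (rule module)
  have "subgroup N (add_monoid M)"
  proof (rule group.subgroupI)
    show "Group.group (add_monoid M)" by (rule M.M.a_group)
    show "N \<noteq> {}" using zero_closed by blast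
    show "inv\<^bsub>add_monoid M\<^esub> x \<in> N" if "x \<in> N" for x
    proof -
      have "(\<ominus>\<^bsub>R\<^esub> \<one>\<^bsub>R\<^esub>) \<odot>\<^bsub>M\<^esub> x \<in> N" using that by simp
      then have "\<ominus>\<^bsub>M\<^esub> x \<in> N" using that subset M.smult_minus_1[of x] by (metis subsetD)
      then show ?thesis by (simp only: a_inv_def[of M])
    qed
  qed (use subset in auto)
  then show ?thesis
    by (intro abelian_subgroupI3 additive_subgroup.intro M.M.abelian_group_axioms)
qed

lemma quotient_module_carrier:
  "carrier (quotient_module M N) = (\<lambda>x. a_r_coset M N x) ` carrier M"
  by (auto simp: quotient_module_def A_RCOSETS_def' )

text \<open>The scalar multiple is defined as a union of cosets over all representatives. It
  collapses to one coset because these cosets coincide and the index set contains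
  \<open>x\<close>.\<close>

lemma quotient_module_ops:
  assumes "submodule R N M"
  shows "zero (quotient_module M N) = a_r_coset M N \<zero>\<^bsub>M\<^esub>"
    and "\<lbrakk>x \<in> carrier M; y \<in> carrier M\<rbrakk> \<Longrightarrow>
      add (quotient_module M N) (a_r_coset M N x) (a_r_coset M N y) = a_r_coset M N (x \<oplus>\<^bsub>M\<^esub> y)"
    and "\<lbrakk>r \<in> carrier R; x \<in> carrier M\<rbrakk> \<Longrightarrow>
      smult (quotient_module M N) r (a_r_coset M N x) = a_r_coset M N (r \<odot>\<^bsub>M\<^esub> x)"
proof -
  interpret submodule R N M by (rule assms)
  interpret M: module R M by (rule module)
  interpret N: abelian_subgroup N M by (rule submodule_abelian_subgroup[OF assms])
  show "zero (quotient_module M N) = a_r_coset M N \<zero>\<^bsub>M\<^esub>"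
    using M.M.a_coset_add_zero[OF subset] by (simp add: quotient_module_def)
  show "add (quotient_module M N) (a_r_coset M N x) (a_r_coset M N y) = a_r_coset M N (x \<oplus>\<^bsub>M\<^esub> y)"
    if "x \<in> carrier M" "y \<in> carrier M"
    using that by (simp add: quotient_module_def N.a_rcos_sum)
  show "smult (quotient_module M N) r (a_r_coset M N x) = a_r_coset M N (r \<odot>\<^bsub>M\<^esub> x)"
    if r: "r \<in> carrier R" and x: "x \<in> carrier M"
  proof -
    have "a_r_coset M N (r \<odot>\<^bsub>M\<^esub> y) = a_r_coset M N (r \<odot>\<^bsub>M\<^esub> x)" if y: "y \<in> a_r_coset M N x" for y
    proof -
      obtain h where h: "h \<in> N" "y = h \<oplus>\<^bsub>M\<^esub> x" using y unfolding a_r_coset_def' by blast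
      have "r \<odot>\<^bsub>M\<^esub> y = (r \<odot>\<^bsub>M\<^esub> h) \<oplus>\<^bsub>M\<^esub> (r \<odot>\<^bsub>M\<^esub> x)"
        using h r x subset by (auto intro!: M.smult_r_distr)
      then have "r \<odot>\<^bsub>M\<^esub> y \<in> a_r_coset M N (r \<odot>\<^bsub>M\<^esub> x)"
        using smult_closed[OF r h(1)] unfolding a_r_coset_def' by blast
      then show ?thesis
        using M.M.a_repr_independence[of "r \<odot>\<^bsub>M\<^esub> y" N "r \<odot>\<^bsub>M\<^esub> x"] r x N.a_subgroup by auto
    qed
    then have "(\<Union>y\<in>a_r_coset M N x. a_r_coset M N (r \<odot>\<^bsub>M\<^esub> y)) =
        (\<Union>y\<in>a_r_coset M N x. a_r_coset M N (r \<odot>\<^bsub>M\<^esub> x))"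
      by (intro SUP_cong refl)
    also have "\<dots> = a_r_coset M N (r \<odot>\<^bsub>M\<^esub> x)"
      using N.a_rcos_self[OF x] by blast
    finally show ?thesis by (simp add: quotient_module_def)
  qed
qed

lemma quotient_module_is_module:
  assumes "submodule R N M"
  shows "module R (quotient_module M N)"
proof -
  interpret M: module R M using assms by (rule submodule.module)
  note ops = quotient_module_ops[OF assms]
  let ?Q = "quotient_module M N" and ?c = "a_r_coset M N"
  have carrier: "?c x \<in> carrier ?Q" if "x \<in> carrier M" for x
    using that unfolding quotient_module_carrier by blast
  have rep: "\<exists>x\<in>carrier M. v = ?c x" if "v \<in> carrier ?Q" for v
    using that unfolding quotient_module_carrier by blast
  show ?thesis
  proof (rule moduleI)
    show "abelian_group ?Q"
    proof (rule abelian_groupI)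
      fix u v w assume "u \<in> carrier ?Q" "v \<in> carrier ?Q" "w \<in> carrier ?Q"
      then obtain x y z where "x \<in> carrier M" "u = ?c x" "y \<in> carrier M" "v = ?c y"
        "z \<in> carrier M" "w = ?c z" using rep by meson
      then show "u \<oplus>\<^bsub>?Q\<^esub> v \<oplus>\<^bsub>?Q\<^esub> w = u \<oplus>\<^bsub>?Q\<^esub> (v \<oplus>\<^bsub>?Q\<^esub> w)"
        by (simp add: ops M.M.a_assoc)
    next
      fix u v assume "u \<in> carrier ?Q" "v \<in> carrier ?Q"
      then obtain x y where "x \<in> carrier M" "u = ?c x" "y \<in> carrier M" "v = ?c y"
        using rep by meson
      then show "u \<oplus>\<^bsub>?Q\<^esub> v \<in> carrier ?Q" "u \<oplus>\<^bsub>?Q\<^esub> v = v \<oplus>\<^bsub>?Q\<^esub> u"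
        by (simp_all add: ops carrier M.M.a_comm)
    next
      fix u assume "u \<in> carrier ?Q"
      then obtain x where x: "x \<in> carrier M" "u = ?c x" using rep by meson
      then show "\<zero>\<^bsub>?Q\<^esub> \<oplus>\<^bsub>?Q\<^esub> u = u" by (simp add: ops)
      have "?c (\<ominus>\<^bsub>M\<^esub> x) \<oplus>\<^bsub>?Q\<^esub> u = \<zero>\<^bsub>?Q\<^esub>" using x by (simp add: ops M.M.l_neg)
      then show "\<exists>v\<in>carrier ?Q. v \<oplus>\<^bsub>?Q\<^esub> u = \<zero>\<^bsub>?Q\<^esub>"
        using carrier[OF M.M.a_inv_closed[OF x(1)]] by blast
    qed (simp add: ops carrier)
  next
    fix r s u v assume "r \<in> carrier R" "s \<in> carrier R" "u \<in> carrier ?Q"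
    moreover obtain x where "x \<in> carrier M" "u = ?c x" using calculation(3) rep by meson
    ultimately show "(r \<oplus>\<^bsub>R\<^esub> s) \<odot>\<^bsub>?Q\<^esub> u = r \<odot>\<^bsub>?Q\<^esub> u \<oplus>\<^bsub>?Q\<^esub> s \<odot>\<^bsub>?Q\<^esub> u"
      "(r \<otimes>\<^bsub>R\<^esub> s) \<odot>\<^bsub>?Q\<^esub> u = r \<odot>\<^bsub>?Q\<^esub> (s \<odot>\<^bsub>?Q\<^esub> u)"
      by (simp_all add: ops M.smult_l_distr M.smult_assoc1)
  next
    fix r u v assume "r \<in> carrier R" "u \<in> carrier ?Q" "v \<in> carrier ?Q"
    moreover obtain x y where "x \<in> carrier M" "u = ?c x" "y \<in> carrier M" "v = ?c y"
      using calculation rep by meson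
    ultimately show "r \<odot>\<^bsub>?Q\<^esub> (u \<oplus>\<^bsub>?Q\<^esub> v) = r \<odot>\<^bsub>?Q\<^esub> u \<oplus>\<^bsub>?Q\<^esub> r \<odot>\<^bsub>?Q\<^esub> v"
      by (simp add: ops M.smult_r_distr)
  next
    fix r u assume "r \<in> carrier R" "u \<in> carrier ?Q"
    moreover obtain x where "x \<in> carrier M" "u = ?c x" using calculation(2) rep by meson
    ultimately show "r \<odot>\<^bsub>?Q\<^esub> u \<in> carrier ?Q" by (simp add: ops carrier)
  next
    fix u assume "u \<in> carrier ?Q"
    moreover obtain x where "x \<in> carrier M" "u = ?c x" using calculation rep by meson
    ultimately show "\<one>\<^bsub>R\<^esub> \<odot>\<^bsub>?Q\<^esub> u = u" by (simp add: ops)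
  qed (rule M.R.cring_axioms)
qed

text \<open>This counts the dual space, which turns a dimension into a cardinality:
  \<open>F a\<close> is the functional with values \<open>a\<close> on a basis. The functionals are
  extensional, so agreement on the carrier means equality.\<close>

lemma (in vectorspace) card_functionals:
  assumes "fin_dim" "finite (carrier K)"
  obtains \<Phi> where "finite \<Phi>" "card \<Phi> = card (carrier K) ^ dim"
    "\<And>\<phi>. \<phi> \<in> \<Phi> \<Longrightarrow> \<phi> \<in> carrier V \<rightarrow>\<^sub>E carrier K"
    "\<And>\<phi> v w. \<lbrakk>\<phi> \<in> \<Phi>; v \<in> carrier V; w \<in> carrier V\<rbrakk> \<Longrightarrow> \<phi> (v \<oplus>\<^bsub>V\<^esub> w) = \<phi> v \<oplus>\<^bsub>K\<^esub> \<phi> w"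
    "\<And>\<phi> r v. \<lbrakk>\<phi> \<in> \<Phi>; r \<in> carrier K; v \<in> carrier V\<rbrakk> \<Longrightarrow> \<phi> (r \<odot>\<^bsub>V\<^esub> v) = r \<otimes>\<^bsub>K\<^esub> \<phi> v"
proof -
  obtain \<beta> where \<beta>: "finite \<beta>" "basis \<beta>" using finite_basis_exists[OF assms(1)] by blast
  have \<beta>V: "\<beta> \<subseteq> carrier V" using \<beta>(2) by (simp add: basis_def)
  have dim: "dim = card \<beta>" by (rule dim_basis[OF \<beta>])
  have unique: "\<exists>!a. a \<in> \<beta> \<rightarrow>\<^sub>E carrier K \<and> lincomb a \<beta> = v" if "v \<in> carrier V" for v
    using basis_criterion[OF \<beta>(1) \<beta>V] \<beta>(2) that by blast
  define coord where "coord v = (THE a. a \<in> \<beta> \<rightarrow>\<^sub>E carrier K \<and> lincomb a \<beta> = v)" for v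
  have coord: "coord v \<in> \<beta> \<rightarrow>\<^sub>E carrier K" "lincomb (coord v) \<beta> = v" if "v \<in> carrier V" for v
    using theI'[OF unique[OF that]] unfolding coord_def by auto
  have coord_eq: "coord v = a" if "a \<in> \<beta> \<rightarrow>\<^sub>E carrier K" "lincomb a \<beta> = v" for a v
  proof -
    have "v \<in> carrier V" using that \<beta>V by (auto intro!: lincomb_closed)
    then show ?thesis unfolding coord_def using unique that by (intro the1_equality) auto
  qed
  have coord_in: "coord v b \<in> carrier K" if "v \<in> carrier V" "b \<in> \<beta>" for v b
    using coord(1)[OF that(1)] that(2) by auto
  have coord_add: "coord (v \<oplus>\<^bsub>V\<^esub> w) = (\<lambda>b\<in>\<beta>. coord v b \<oplus>\<^bsub>K\<^esub> coord w b)"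
    if vw: "v \<in> carrier V" "w \<in> carrier V" for v w
  proof (rule coord_eq)
    have "lincomb (\<lambda>b\<in>\<beta>. coord v b \<oplus>\<^bsub>K\<^esub> coord w b) \<beta> = lincomb (\<lambda>b. coord v b \<oplus>\<^bsub>K\<^esub> coord w b) \<beta>"
      using \<beta>V coord_in vw by (intro lincomb_cong) auto
    also have "\<dots> = lincomb (coord v) \<beta> \<oplus>\<^bsub>V\<^esub> lincomb (coord w) \<beta>"
      using \<beta>(1) \<beta>V coord_in vw by (intro lincomb_sum) auto
    finally show "lincomb (\<lambda>b\<in>\<beta>. coord v b \<oplus>\<^bsub>K\<^esub> coord w b) \<beta> = v \<oplus>\<^bsub>V\<^esub> w"
      using coord(2) vw by simp
  qed (use coord_in vw in auto)
  have coord_smult: "coord (r \<odot>\<^bsub>V\<^esub> v) = (\<lambda>b\<in>\<beta>. r \<otimes>\<^bsub>K\<^esub> coord v b)"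
    if r: "r \<in> carrier K" and v: "v \<in> carrier V" for r v
  proof (rule coord_eq)
    have "lincomb (\<lambda>b\<in>\<beta>. r \<otimes>\<^bsub>K\<^esub> coord v b) \<beta> = lincomb (\<lambda>b. r \<otimes>\<^bsub>K\<^esub> coord v b) \<beta>"
      using \<beta>V coord_in r v by (intro lincomb_cong) auto
    also have "\<dots> = r \<odot>\<^bsub>V\<^esub> lincomb (coord v) \<beta>"
      using \<beta>(1) \<beta>V coord_in r v by (intro lincomb_smult) auto
    finally show "lincomb (\<lambda>b\<in>\<beta>. r \<otimes>\<^bsub>K\<^esub> coord v b) \<beta> = r \<odot>\<^bsub>V\<^esub> v"
      using coord(2) v by simp
  qed (use coord_in r v in auto)
  have coord_basis: "coord b = (\<lambda>b'\<in>\<beta>. if b' = b then \<one>\<^bsub>K\<^esub> else \<zero>\<^bsub>K\<^esub>)" if b: "b \<in> \<beta>" for b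
  proof (rule coord_eq)
    have "lincomb (\<lambda>b'\<in>\<beta>. if b' = b then \<one>\<^bsub>K\<^esub> else \<zero>\<^bsub>K\<^esub>) \<beta> =
        (\<Oplus>\<^bsub>V\<^esub>b'\<in>\<beta>. if b = b' then b' else \<zero>\<^bsub>V\<^esub>)"
      unfolding lincomb_def using \<beta>V by (intro finsum_cong') auto
    also have "\<dots> = b"
      using \<beta>(1) \<beta>V b by (intro finsum_singleton) auto
    finally show "lincomb (\<lambda>b'\<in>\<beta>. if b' = b then \<one>\<^bsub>K\<^esub> else \<zero>\<^bsub>K\<^esub>) \<beta> = b" .
  qed auto
  define F where "F a = (\<lambda>v\<in>carrier V. \<Oplus>\<^bsub>K\<^esub>b\<in>\<beta>. a b \<otimes>\<^bsub>K\<^esub> coord v b)" for a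
  have F_basis: "F a b = a b" if a: "a \<in> \<beta> \<rightarrow>\<^sub>E carrier K" and b: "b \<in> \<beta>" for a b
  proof -
    have ab: "a b' \<in> carrier K" if "b' \<in> \<beta>" for b' using a that by auto
    have "F a b = (\<Oplus>\<^bsub>K\<^esub>b'\<in>\<beta>. if b = b' then a b' else \<zero>\<^bsub>K\<^esub>)"
      unfolding F_def using b \<beta>V ab by (auto simp: coord_basis intro!: R.finsum_cong')
    also have "\<dots> = a b" using \<beta>(1) b ab by (intro R.finsum_singleton) auto
    finally show ?thesis .
  qed
  have "inj_on F (\<beta> \<rightarrow>\<^sub>E carrier K)"
  proof (rule inj_onI)
    fix a a' assume a: "a \<in> \<beta> \<rightarrow>\<^sub>E carrier K" "a' \<in> \<beta> \<rightarrow>\<^sub>E carrier K" and eq: "F a = F a'"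
    show "a = a'"
    proof (rule PiE_ext[OF a])
      show "a b = a' b" if "b \<in> \<beta>" for b
        using F_basis[OF a(1) that] F_basis[OF a(2) that] eq by simp
    qed
  qed
  then have card: "card (F ` (\<beta> \<rightarrow>\<^sub>E carrier K)) = card (carrier K) ^ dim"
    using \<beta>(1) by (simp add: card_image card_PiE dim)
  show thesis
  proof (rule that[of "F ` (\<beta> \<rightarrow>\<^sub>E carrier K)"])
    show "finite (F ` (\<beta> \<rightarrow>\<^sub>E carrier K))" using \<beta>(1) assms(2) by (simp add: finite_PiE)
    show "card (F ` (\<beta> \<rightarrow>\<^sub>E carrier K)) = card (carrier K) ^ dim" by (rule card)
  next
    fix \<phi> assume "\<phi> \<in> F ` (\<beta> \<rightarrow>\<^sub>E carrier K)"
    then obtain a where a: "a \<in> \<beta> \<rightarrow>\<^sub>E carrier K" and \<phi>: "\<phi> = F a" by auto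
    have ab: "a b \<in> carrier K" if "b \<in> \<beta>" for b using a that by auto
    show "\<phi> \<in> carrier V \<rightarrow>\<^sub>E carrier K"
      unfolding \<phi> F_def using ab coord_in by (auto intro!: R.finsum_closed)
    show "\<phi> (v \<oplus>\<^bsub>V\<^esub> w) = \<phi> v \<oplus>\<^bsub>K\<^esub> \<phi> w" if "v \<in> carrier V" "w \<in> carrier V" for v w
    proof -
      have "(\<Oplus>\<^bsub>K\<^esub>b\<in>\<beta>. a b \<otimes>\<^bsub>K\<^esub> coord (v \<oplus>\<^bsub>V\<^esub> w) b) =
          (\<Oplus>\<^bsub>K\<^esub>b\<in>\<beta>. a b \<otimes>\<^bsub>K\<^esub> coord v b \<oplus>\<^bsub>K\<^esub> a b \<otimes>\<^bsub>K\<^esub> coord w b)"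
        using that ab coord_in by (intro R.finsum_cong') (auto simp: coord_add R.r_distr)
      also have "\<dots> = (\<Oplus>\<^bsub>K\<^esub>b\<in>\<beta>. a b \<otimes>\<^bsub>K\<^esub> coord v b) \<oplus>\<^bsub>K\<^esub> (\<Oplus>\<^bsub>K\<^esub>b\<in>\<beta>. a b \<otimes>\<^bsub>K\<^esub> coord w b)"
        using that ab coord_in by (intro R.finsum_addf) auto
      finally show ?thesis using that by (simp add: \<phi> F_def)
    qed
    show "\<phi> (r \<odot>\<^bsub>V\<^esub> v) = r \<otimes>\<^bsub>K\<^esub> \<phi> v" if "r \<in> carrier K" "v \<in> carrier V" for r v
    proof -
      have "(\<Oplus>\<^bsub>K\<^esub>b\<in>\<beta>. a b \<otimes>\<^bsub>K\<^esub> coord (r \<odot>\<^bsub>V\<^esub> v) b) = (\<Oplus>\<^bsub>K\<^esub>b\<in>\<beta>. r \<otimes>\<^bsub>K\<^esub> (a b \<otimes>\<^bsub>K\<^esub> coord v b))"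
        using that ab coord_in by (intro R.finsum_cong') (auto simp: coord_smult R.m_ac)
      also have "\<dots> = r \<otimes>\<^bsub>K\<^esub> (\<Oplus>\<^bsub>K\<^esub>b\<in>\<beta>. a b \<otimes>\<^bsub>K\<^esub> coord v b)"
        using that ab coord_in \<beta>(1) by (intro R.finsum_rdistr[symmetric]) auto
      finally show ?thesis using that by (simp add: \<phi> F_def)
    qed
  qed
qed

section \<open>First homology of complexes with complete graph\<close>

text \<open>Since \<open>x mod 0 = x\<close>, all computations over the integers (\<open>m = 0\<close>) and over the residue rings
  can be done at once, with integer representatives.\<close>

definition coeff_ring :: "int \<Rightarrow> int ring" where
  "coeff_ring m = (if m = 0 then int_ring else residue_ring m)"

lemma coeff_ring_cring:
  assumes "m = 0 \<or> m > 1"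
  shows "cring (coeff_ring m)"
proof (cases "m = 0")
  case True
  then show ?thesis by (simp add: coeff_ring_def int_is_cring)
next
  case False
  then interpret residues m "residue_ring m" using assms by unfold_locales auto
  show ?thesis using False cring by (simp add: coeff_ring_def)
qed

lemma coeff_ring_simps:
  assumes "m = 0 \<or> m > 1"
  shows "carrier (coeff_ring m) = {x. x mod m = x}"
    "zero (coeff_ring m) = 0" "one (coeff_ring m) = 1"
    "add (coeff_ring m) x y = (x + y) mod m"
    "monoid.mult (coeff_ring m) x y = (x * y) mod m"
proof -
  have "carrier (coeff_ring m) = {x. x mod m = x} \<and> zero (coeff_ring m) = 0 \<and>
    one (coeff_ring m) = 1 \<and> add (coeff_ring m) x y = (x + y) mod m \<and>
    monoid.mult (coeff_ring m) x y = (x * y) mod m"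
  proof (cases "m = 0")
    case True
    then show ?thesis by (simp add: coeff_ring_def)
  next
    case False
    then have "m > 1" using assms by simp
    then have "x \<in> {0..m - 1} \<longleftrightarrow> x \<in> {x. x mod m = x}" for x
      unfolding atLeastAtMost_iff mem_Collect_eq
      using pos_mod_sign[of m x] pos_mod_bound[of m x] mod_pos_pos_trivial[of x m] by linarith
    then have "{0..m - 1} = {x. x mod m = x}" by blast
    then show ?thesis using False by (simp add: coeff_ring_def residue_ring_def)
  qed
  then show "carrier (coeff_ring m) = {x. x mod m = x}"
    "zero (coeff_ring m) = 0" "one (coeff_ring m) = 1"
    "add (coeff_ring m) x y = (x + y) mod m"
    "monoid.mult (coeff_ring m) x y = (x * y) mod m"
    by blast+
qed

lemma coeff_ring_a_inv:
  assumes m: "m = 0 \<or> m > 1" and x: "x mod m = x"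
  shows "a_inv (coeff_ring m) x = (- x) mod m"
proof -
  interpret cring "coeff_ring m" by (rule coeff_ring_cring[OF m])
  show ?thesis
    by (rule minus_equality) (simp_all add: coeff_ring_simps[OF m] mod_add_left_eq x)
qed

lemma coeff_ring_finsum:
  assumes m: "m = 0 \<or> m > 1" and "finite A" and "\<And>x. x \<in> A \<Longrightarrow> f x mod m = f x"
  shows "finsum (coeff_ring m) f A = sum f A mod m"
proof -
  interpret cring "coeff_ring m" by (rule coeff_ring_cring[OF m])
  show ?thesis using assms(2,3)
  proof (induction A rule: finite_induct)
    case (insert x A)
    then show ?case
      by (subst finsum_insert) (auto simp: coeff_ring_simps[OF m] mod_add_right_eq)
  qed (simp add: coeff_ring_simps[OF m])
qed

section \<open>Chains and boundary maps in integer coordinates\<close>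

locale chain_complex =
  fixes n :: nat and S :: "nat set set" and m :: int
  assumes n: "n \<ge> 1"
    and complex: "simplicial_complex_on {1..n} S"
    and skeleton: "\<And>\<sigma>. \<lbrakk>\<sigma> \<subseteq> {1..n}; card \<sigma> \<in> {1, 2}\<rbrakk> \<Longrightarrow> \<sigma> \<in> S"
    and m: "m = 0 \<or> m > 1"
begin

abbreviation "R \<equiv> coeff_ring m"
abbreviation "V \<equiv> {1..n}"

sublocale R: cring R by (rule coeff_ring_cring[OF m])

lemmas R_simps = coeff_ring_simps[OF m]

text \<open>The boundary before reduction modulo \<open>m\<close>. Linearity and the vanishing of
  double boundaries thus become identities between integers, valid for arbitrary integer functions
  \<open>c\<close>.\<close>

definition bd :: "(nat set \<Rightarrow> int) \<Rightarrow> nat set \<Rightarrow> int" where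
  "bd c \<tau> = (\<Sum>v\<in>V - \<tau>. if insert v \<tau> \<in> S then (-1) ^ below v \<tau> * c (insert v \<tau>) else 0)"

lemma finite_simplex: "\<sigma> \<in> S \<Longrightarrow> finite \<sigma>" and simplex_subset: "\<sigma> \<in> S \<Longrightarrow> \<sigma> \<subseteq> V"
  using complex unfolding simplicial_complex_on_def by blast+

lemma finite_faces: "finite (faces S k)"
  by (rule finite_subset[of _ "Pow V"]) (use simplex_subset in \<open>auto simp: faces_def simp del: atLeastAtMost_iff\<close>)

lemma bd_add: "bd (\<lambda>\<sigma>. c \<sigma> + d \<sigma>) \<tau> = bd c \<tau> + bd d \<tau>"
  unfolding bd_def sum.distrib[symmetric] by (intro sum.cong) (auto simp: algebra_simps)

lemma bd_mult: "bd (\<lambda>\<sigma>. a * c \<sigma>) \<tau> = a * bd c \<tau>"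
  unfolding bd_def sum_distrib_left by (intro sum.cong) auto

lemma bd_cong_mod:
  assumes "\<And>v. v \<in> V - \<tau> \<Longrightarrow> insert v \<tau> \<in> S \<Longrightarrow> c (insert v \<tau>) mod m = d (insert v \<tau>) mod m"
  shows "bd c \<tau> mod m = bd d \<tau> mod m"
proof -
  have "bd c \<tau> mod m = (\<Sum>v\<in>V - \<tau>.
      (if insert v \<tau> \<in> S then (-1) ^ below v \<tau> * c (insert v \<tau>) else 0) mod m) mod m"
    unfolding bd_def by (simp add: mod_sum_eq)
  also have "\<dots> = (\<Sum>v\<in>V - \<tau>.
      (if insert v \<tau> \<in> S then (-1) ^ below v \<tau> * d (insert v \<tau>) else 0) mod m) mod m"
    by (rule arg_cong[of _ _ "\<lambda>x. x mod m"], rule sum.cong)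
      (auto intro!: mod_mult_cong[OF refl assms])
  also have "\<dots> = bd d \<tau> mod m"
    unfolding bd_def by (simp add: mod_sum_eq)
  finally show ?thesis .
qed

lemma carrier_chains: "carrier (chains R S k) = faces S k \<rightarrow>\<^sub>E carrier R"
  by (simp add: chains_def R.func_space_def)

lemma chains_simps:
  "zero (chains R S k) = (\<lambda>\<sigma>\<in>faces S k. 0)"
  "add (chains R S k) c d = (\<lambda>\<sigma>\<in>faces S k. (c \<sigma> + d \<sigma>) mod m)"
  "smult (chains R S k) a c = (\<lambda>\<sigma>\<in>faces S k. (a * c \<sigma>) mod m)"
  by (simp_all add: chains_def R.func_space_def R_simps)

lemma insert_face:
  assumes "\<tau> \<in> faces S k" "v \<notin> \<tau>" "insert v \<tau> \<in> S"
  shows "insert v \<tau> \<in> faces S (Suc k)"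
  using assms finite_simplex by (auto simp: faces_def)

lemma boundary_eq:
  assumes c: "c \<in> carrier (chains R S (Suc k))"
  shows "boundary R S k c = (\<lambda>\<tau>\<in>faces S k. bd c \<tau> mod m)"
  unfolding boundary_def
proof (rule restrict_ext)
  fix \<tau> assume \<tau>: "\<tau> \<in> faces S k"
  let ?X = "{v. v \<notin> \<tau> \<and> insert v \<tau> \<in> S}"
  have X: "?X = {v \<in> V - \<tau>. insert v \<tau> \<in> S}" using simplex_subset by blast
  have val: "c (insert v \<tau>) mod m = c (insert v \<tau>)" if "v \<in> ?X" for v
    using c insert_face[OF \<tau>] that by (auto simp: carrier_chains R_simps)
  have "finsum R (\<lambda>v. if even (card {u\<in>\<tau>. u < v}) then c (insert v \<tau>)
        else a_inv R (c (insert v \<tau>))) ?X =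
      (\<Sum>v\<in>?X. if even (card {u\<in>\<tau>. u < v}) then c (insert v \<tau>)
        else a_inv R (c (insert v \<tau>))) mod m"
    using X val by (intro coeff_ring_finsum m) (auto simp: coeff_ring_a_inv[OF m])
  also have "\<dots> = (\<Sum>v\<in>?X. ((-1) ^ below v \<tau> * c (insert v \<tau>)) mod m) mod m"
    using val by (intro arg_cong[of _ _ "\<lambda>x. x mod m"] sum.cong refl)
      (auto simp: coeff_ring_a_inv[OF m] below_def)
  also have "\<dots> = bd c \<tau> mod m"
    unfolding bd_def X by (simp add: mod_sum_eq sum.inter_filter[symmetric])
  finally show "finsum R (\<lambda>v. if even (card {u\<in>\<tau>. u < v}) then c (insert v \<tau>)
        else a_inv R (c (insert v \<tau>))) ?X = bd c \<tau> mod m" .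
qed

lemma chains_module: "module R (chains R S k)"
  unfolding chains_def by (rule R.func_space_is_module)

lemma boundary_closed:
  assumes "c \<in> carrier (chains R S (Suc k))"
  shows "boundary R S k c \<in> carrier (chains R S k)"
  unfolding boundary_eq[OF assms] by (auto simp: carrier_chains R_simps)

lemma boundary_add:
  assumes c: "c \<in> carrier (chains R S (Suc k))" and d: "d \<in> carrier (chains R S (Suc k))"
  shows "boundary R S k (add (chains R S (Suc k)) c d) =
    add (chains R S k) (boundary R S k c) (boundary R S k d)"
proof -
  have sum: "add (chains R S (Suc k)) c d \<in> carrier (chains R S (Suc k))"
    by (auto simp: carrier_chains chains_simps R_simps)
  have "bd (add (chains R S (Suc k)) c d) \<tau> mod m = (bd c \<tau> + bd d \<tau>) mod m"
    if "\<tau> \<in> faces S k" for \<tau>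
  proof -
    have "bd (add (chains R S (Suc k)) c d) \<tau> mod m = bd (\<lambda>\<sigma>. c \<sigma> + d \<sigma>) \<tau> mod m"
      by (rule bd_cong_mod) (simp add: chains_simps insert_face[OF that])
    then show ?thesis by (simp only: bd_add)
  qed
  then show ?thesis
    unfolding boundary_eq[OF c] boundary_eq[OF d] boundary_eq[OF sum]
      chains_simps(2)[of k]
    by (intro restrict_ext) (simp add: mod_add_eq)
qed

lemma boundary_smult:
  assumes c: "c \<in> carrier (chains R S (Suc k))" and a: "a \<in> carrier R"
  shows "boundary R S k (smult (chains R S (Suc k)) a c) = smult (chains R S k) a (boundary R S k c)"
proof -
  have "bd (smult (chains R S (Suc k)) a c) \<tau> mod m = (a * bd c \<tau>) mod m"
    if "\<tau> \<in> faces S k" for \<tau>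
  proof -
    have "bd (smult (chains R S (Suc k)) a c) \<tau> mod m = bd (\<lambda>\<sigma>. a * c \<sigma>) \<tau> mod m"
      by (rule bd_cong_mod) (simp add: chains_simps insert_face[OF that])
    then show ?thesis by (simp only: bd_mult)
  qed
  then show ?thesis
    unfolding boundary_eq[OF c] boundary_eq[OF module.smult_closed[OF chains_module a c]]
      chains_simps(3)[of k]
    by (intro restrict_ext) (simp add: mod_mult_right_eq)
qed

lemma boundary_hom: "mod_hom R (chains R S (Suc k)) (chains R S k) (boundary R S k)"
  by (intro mod_hom.intro mod_hom_axioms.intro chains_module)
    (auto simp: module_hom_def boundary_closed boundary_add boundary_smult)

text \<open>Adding \<open>v\<close> and then \<open>w\<close> to \<open>{a}\<close> reaches the same
  triangle as the other order, with the opposite sign. The terms \<open>t v w\<close> are extended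
  by zero to all pairs, so that exchanging the sums shows the total to be its own negative.\<close>

lemma bd_bd: "bd (bd c) {a} = 0"
proof -
  define t where "t v w = (if v \<noteq> a \<and> w \<noteq> a \<and> v \<noteq> w \<and> insert w {v, a} \<in> S
    then (-1) ^ below v {a} * ((-1) ^ below w {v, a} * c (insert w {v, a})) else 0)" for v w
  have face: "\<tau> \<in> S" if "\<sigma> \<in> S" "\<tau> \<subseteq> \<sigma>" "\<tau> \<noteq> {}" for \<sigma> \<tau>
    using complex that unfolding simplicial_complex_on_def by blast
  have below1: "below v {a} = (if a < v then 1 else 0)" for v
    unfolding below_def by (simp add: Collect_conv_if)
  have below2: "below w {v, a} = (if a < w then 1 else 0) + (if v < w then 1 else 0)"
    if "v \<noteq> a" for v w
    using that by (simp add: below_insert below1)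
  have "bd (bd c) {a} = (\<Sum>v\<in>V - {a}. if {v, a} \<in> S then (-1) ^ below v {a} * bd c {v, a} else 0)"
    unfolding bd_def[of "bd c"] ..
  also have "\<dots> = (\<Sum>v\<in>V - {a}. \<Sum>w\<in>V - {v, a}. t v w)"
  proof (rule sum.cong[OF refl])
    fix v assume v: "v \<in> V - {a}"
    show "(if {v, a} \<in> S then (-1) ^ below v {a} * bd c {v, a} else 0) = (\<Sum>w\<in>V - {v, a}. t v w)"
    proof (cases "{v, a} \<in> S")
      case True
      have "(-1) ^ below v {a} * bd c {v, a} = (\<Sum>w\<in>V - {v, a}. t v w)"
        unfolding bd_def sum_distrib_left by (rule sum.cong) (use v in \<open>auto simp: t_def\<close>)
      then show ?thesis using True by simp
    next
      case False
      then have "insert w {v, a} \<notin> S" for w using face[of "insert w {v, a}" "{v, a}"] by blast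
      then have "t v w = 0" for w by (simp add: t_def)
      then show ?thesis using False by simp
    qed
  qed
  also have "\<dots> = (\<Sum>v\<in>V. \<Sum>w\<in>V. t v w)"
  proof (rule sum.mono_neutral_cong_left)
    show "(\<Sum>w\<in>V - {v, a}. t v w) = (\<Sum>w\<in>V. t v w)" for v
      by (rule sum.mono_neutral_left) (auto simp: t_def)
    show "\<forall>v\<in>V - (V - {a}). (\<Sum>w\<in>V. t v w) = 0"
      by (auto simp: t_def)
  qed auto
  finally have eq: "bd (bd c) {a} = (\<Sum>v\<in>V. \<Sum>w\<in>V. t v w)" .
  have anti: "t v w = - t w v" for v w
  proof (cases "v \<noteq> a \<and> w \<noteq> a \<and> v \<noteq> w")
    case True
    then have "(-1) ^ below v {a} * (-1) ^ below w {v, a} =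
        - ((-1) ^ below w {a} * (-1) ^ below v {w, a} :: int)"
      by (auto simp: below1 below2)
    moreover have "insert v {w, a} = insert w {v, a}" by auto
    ultimately show ?thesis using True unfolding t_def by (simp add: mult.assoc[symmetric])
  qed (auto simp: t_def)
  have "(\<Sum>v\<in>V. \<Sum>w\<in>V. t v w) = (\<Sum>v\<in>V. \<Sum>w\<in>V. - t w v)"
    by (intro sum.cong refl anti)
  also have "\<dots> = - (\<Sum>v\<in>V. \<Sum>w\<in>V. t w v)"
    by (simp only: sum_negf)
  also have "\<dots> = - (\<Sum>v\<in>V. \<Sum>w\<in>V. t v w)" by (subst sum.swap) simp
  finally show ?thesis using eq by simp
qed

end

text \<open>The entry of the boundary matrix at \<open>\<tau>\<close> and \<open>\<sigma>\<close>.
  At most one term of the sum is nonzero, since \<open>v\<close> must be the only element of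
  \<open>\<sigma> - \<tau>\<close>.\<close>

definition incidence :: "nat set \<Rightarrow> nat set \<Rightarrow> int" where
  "incidence \<tau> \<sigma> = (\<Sum>v\<in>\<sigma> - \<tau>. if insert v \<tau> = \<sigma> then (-1) ^ below v \<tau> else 0)"

text \<open>For \<open>n >= 1\<close> these are the edges outside the star at \<open>n\<close>, a
  spanning tree of the complete graph. There are as many of them as triangles in a hypertree, so the
  boundary matrix with these rows is square.\<close>

definition base_edges :: "nat \<Rightarrow> nat set set" where
  "base_edges n = {e. e \<subseteq> {1..<n} \<and> card e = 2}"

lemma finite_base_edges: "finite (base_edges n)"
  by (rule finite_subset[of _ "Pow {1..<n}"]) (auto simp: base_edges_def)

text \<open>The other two edges of the cone triangle contain \<open>n\<close>. The sign at
  \<open>e\<close> is positive because both vertices of \<open>e\<close> lie below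
  \<open>n\<close>.\<close>

lemma incidence_cone:
  assumes "\<tau> \<in> base_edges n" "e \<in> base_edges n"
  shows "incidence \<tau> (insert n e) = (if \<tau> = e then 1 else 0)"
proof -
  have n: "n \<notin> \<tau>" "n \<notin> e" using assms by (auto simp: base_edges_def)
  have eq: "v = n \<and> \<tau> = e" if "insert v \<tau> = insert n e" for v
    using that n by (metis insert_iff insert_ident)
  show ?thesis
  proof (cases "\<tau> = e")
    case True
    have "below n e = card e"
      unfolding below_def using assms(2) by (intro arg_cong[of _ _ card]) (auto simp: base_edges_def)
    moreover have "insert n e - e = {n}" using n by auto
    ultimately show ?thesis using True assms(2) by (simp add: incidence_def base_edges_def)
  next
    case False
    then have "insert v \<tau> \<noteq> insert n e" for v using eq[of v] by blast
    then show ?thesis using False by (simp add: incidence_def)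
  qed
qed

section \<open>One-cycles in the presence of the complete graph\<close>

context chain_complex
begin

abbreviation "E \<equiv> base_edges n"

lemma faces_1: "faces S 1 = {e. e \<subseteq> V \<and> card e = 2}"
  using simplex_subset skeleton by (auto simp: faces_def)

lemma faces_0: "\<tau> \<in> faces S 0 \<longleftrightarrow> (\<exists>a\<in>V. \<tau> = {a})"
proof
  assume "\<tau> \<in> faces S 0"
  then have "card \<tau> = 1" "\<tau> \<subseteq> V" using simplex_subset by (auto simp: faces_def)
  then show "\<exists>a\<in>V. \<tau> = {a}" by (auto simp: card_1_singleton_iff)
next
  assume "\<exists>a\<in>V. \<tau> = {a}"
  then obtain a where a: "a \<in> V" "\<tau> = {a}" by blast
  then have "{a} \<in> S" by (intro skeleton) auto
  then show "\<tau> \<in> faces S 0" using a by (simp add: faces_def)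
qed

lemma E_faces: "E \<subseteq> faces S 1"
  unfolding faces_1 base_edges_def by auto

lemma edge_in: "\<lbrakk>a \<in> V; v \<in> V; a \<noteq> v\<rbrakk> \<Longrightarrow> {v, a} \<in> faces S 1"
  unfolding faces_1 by auto

definition Z :: "(int, nat set \<Rightarrow> int) module" where
  "Z = cycles1 R S"

lemma carrier_Z: "carrier Z = {c \<in> carrier (chains R S 1). \<forall>a\<in>V. bd c {a} mod m = 0}"
proof -
  have "boundary R S 0 c = zero (chains R S 0) \<longleftrightarrow> (\<forall>a\<in>V. bd c {a} mod m = 0)"
    if c: "c \<in> carrier (chains R S 1)" for c
  proof -
    have eq: "boundary R S 0 c = (\<lambda>\<tau>\<in>faces S 0. bd c \<tau> mod m)"
      using c by (intro boundary_eq) simp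
    show ?thesis
    proof
      assume "boundary R S 0 c = zero (chains R S 0)"
      then have eq0: "(\<lambda>\<tau>\<in>faces S 0. bd c \<tau> mod m) = (\<lambda>\<sigma>\<in>faces S 0. 0)"
        unfolding eq chains_simps .
      show "\<forall>a\<in>V. bd c {a} mod m = 0"
      proof
        fix a assume "a \<in> V"
        then have "{a} \<in> faces S 0" using faces_0 by blast
        then show "bd c {a} mod m = 0" using fun_cong[OF eq0, of "{a}"] by simp
      qed
    next
      assume "\<forall>a\<in>V. bd c {a} mod m = 0"
      then show "boundary R S 0 c = zero (chains R S 0)"
        unfolding eq chains_simps by (intro restrict_ext) (metis faces_0)
    qed
  qed
  then show ?thesis
    unfolding Z_def cycles1_def by (auto simp: a_kernel_def')
qed

lemma Z_simps:
  "zero Z = (\<lambda>\<sigma>\<in>faces S 1. 0)"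
  "add Z c d = (\<lambda>\<sigma>\<in>faces S 1. (c \<sigma> + d \<sigma>) mod m)"
  "smult Z a c = (\<lambda>\<sigma>\<in>faces S 1. (a * c \<sigma>) mod m)"
  by (simp_all add: Z_def cycles1_def chains_simps)

lemma Z_module: "module R Z"
proof -
  interpret mod_hom R "chains R S (Suc 0)" "chains R S 0" "boundary R S 0"
    by (rule boundary_hom)
  have "Z = (chains R S 1)\<lparr>carrier := ker\<rparr>"
    unfolding Z_def cycles1_def a_kernel_def' ker_def by simp
  then show ?thesis
    using module.submodule_is_module[OF chains_module ker_is_submodule] by simp
qed

lemma Z_val: "c \<in> carrier Z \<Longrightarrow> e \<in> faces S 1 \<Longrightarrow> c e mod m = c e"
  by (auto simp: carrier_Z carrier_chains R_simps)

text \<open>The edges at \<open>n\<close> form a spanning tree, which supports no nonzero cycle.\<close>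

lemma cycle_eqI:
  assumes c: "c \<in> carrier Z" and d: "d \<in> carrier Z" and eq: "\<And>e. e \<in> E \<Longrightarrow> c e = d e"
  shows "c = d"
proof -
  have cone: "c {n, a} = d {n, a}" if a: "a \<in> V" "a \<noteq> n" for a
  proof -
    have edge: "{v, a} \<in> S" if "v \<in> V - {a}" for v
      using edge_in[of a v] a that by (auto simp: faces_def)
    \<comment> \<open>Every edge at \<open>a\<close> except \<open>{n, a}\<close> avoids
      \<open>n\<close>, so the cycle condition at \<open>a\<close> determines the value on
      \<open>{n, a}\<close>.\<close>
    have split: "bd f {a} = (-1) ^ below n {a} * f {n, a} +
        (\<Sum>v\<in>V - {a} - {n}. (-1) ^ below v {a} * f {v, a})" for f
    proof -
      have "bd f {a} = (\<Sum>v\<in>V - {a}. (-1) ^ below v {a} * f {v, a})"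
        unfolding bd_def using edge by (intro sum.cong) auto
      also have "\<dots> = (-1) ^ below n {a} * f {n, a} +
          (\<Sum>v\<in>V - {a} - {n}. (-1) ^ below v {a} * f {v, a})"
        using a n by (intro sum.remove) auto
      finally show ?thesis .
    qed
    have below: "below n {a} = 1"
    proof -
      have "{x\<in>{a}. x < n} = {a}" using a by auto
      then show ?thesis by (simp add: below_def)
    qed
    have "(\<Sum>v\<in>V - {a} - {n}. (-1) ^ below v {a} * c {v, a}) =
        (\<Sum>v\<in>V - {a} - {n}. (-1) ^ below v {a} * d {v, a})"
    proof (rule sum.cong[OF refl])
      fix v assume "v \<in> V - {a} - {n}"
      then have "{v, a} \<in> E" using a by (auto simp: base_edges_def)
      then show "(-1) ^ below v {a} * c {v, a} = (-1) ^ below v {a} * d {v, a}"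
        using eq by simp
    qed
    then have "bd d {a} - bd c {a} = c {n, a} - d {n, a}"
      unfolding split below by simp
    moreover have "bd c {a} mod m = 0" "bd d {a} mod m = 0"
      using c d a(1) by (auto simp: carrier_Z)
    ultimately have "(c {n, a} - d {n, a}) mod m = 0"
      by (metis diff_zero mod_0 mod_diff_eq)
    then have "c {n, a} mod m = d {n, a} mod m"
      by (simp add: mod_eq_dvd_iff mod_eq_0_iff_dvd)
    moreover have "{n, a} \<in> faces S 1" using edge_in[of a n] a n by simp
    ultimately show ?thesis using Z_val[OF c] Z_val[OF d] by metis
  qed
  have ext: "c \<in> faces S 1 \<rightarrow>\<^sub>E carrier R" "d \<in> faces S 1 \<rightarrow>\<^sub>E carrier R"
    using c d by (auto simp: carrier_Z carrier_chains)
  show ?thesis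
  proof (rule PiE_ext[OF ext])
    fix e assume "e \<in> faces S 1"
    then have e: "e \<subseteq> V" "card e = 2" unfolding faces_1 by auto
    show "c e = d e"
    proof (cases "n \<in> e")
      case True
      have "card (e - {n}) = 1" using e True by simp
      then obtain a where "e - {n} = {a}" by (auto simp: card_1_singleton_iff)
      then have "e = {n, a}" "a \<in> V" "a \<noteq> n" using True e by auto
      then show ?thesis using cone by simp
    next
      case False
      have "x < n" if "x \<in> e" for x
        using that e(1) False by (metis atLeastAtMost_iff le_neq_implies_less subsetD)
      then have "e \<in> E" using e by (auto simp: base_edges_def)
      then show ?thesis by (rule eq)
    qed
  qed
qed

section \<open>Cone cycles as a basis of the cycle module\<close>

lemma bd_zero: "bd (\<lambda>_. 0) \<tau> = 0"
  unfolding bd_def by (intro sum.neutral) auto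

lemma bd_sum: "bd (\<lambda>\<tau>. \<Sum>i\<in>I. g i \<tau>) \<tau> = (\<Sum>i\<in>I. bd (g i) \<tau>)"
proof (induction I rule: infinite_finite_induct)
  case (insert i I)
  then show ?case using bd_add[of "g i" "\<lambda>\<tau>. \<Sum>i\<in>I. g i \<tau>" \<tau>] by simp
qed (simp_all add: bd_zero)

lemma bd_incidence:
  assumes "\<tau> \<in> faces S k"
  shows "bd c \<tau> = (\<Sum>\<sigma>\<in>faces S (Suc k). incidence \<tau> \<sigma> * c \<sigma>)"
proof -
  have "bd c \<tau> = (\<Sum>v\<in>V - \<tau>. \<Sum>\<sigma>\<in>faces S (Suc k).
      if insert v \<tau> = \<sigma> then (-1) ^ below v \<tau> * c \<sigma> else 0)"
    unfolding bd_def
  proof (rule sum.cong[OF refl])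
    fix v assume v: "v \<in> V - \<tau>"
    have "insert v \<tau> \<in> S \<longleftrightarrow> insert v \<tau> \<in> faces S (Suc k)"
      using insert_face[OF assms, of v] v by (auto simp: faces_def)
    then show "(if insert v \<tau> \<in> S then (-1) ^ below v \<tau> * c (insert v \<tau>) else 0) =
        (\<Sum>\<sigma>\<in>faces S (Suc k). if insert v \<tau> = \<sigma> then (-1) ^ below v \<tau> * c \<sigma> else 0)"
      using finite_faces by (simp add: sum.delta')
  qed
  also have "\<dots> = (\<Sum>\<sigma>\<in>faces S (Suc k). \<Sum>v\<in>V - \<tau>.
      if insert v \<tau> = \<sigma> then (-1) ^ below v \<tau> * c \<sigma> else 0)"
    by (rule sum.swap)
  also have "\<dots> = (\<Sum>\<sigma>\<in>faces S (Suc k). incidence \<tau> \<sigma> * c \<sigma>)"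
  proof (rule sum.cong[OF refl])
    fix \<sigma> assume "\<sigma> \<in> faces S (Suc k)"
    then have \<sigma>: "\<sigma> \<subseteq> V" using simplex_subset by (auto simp: faces_def)
    have "incidence \<tau> \<sigma> * c \<sigma> = (\<Sum>v\<in>\<sigma> - \<tau>. if insert v \<tau> = \<sigma> then (-1) ^ below v \<tau> * c \<sigma> else 0)"
      unfolding incidence_def sum_distrib_right by (rule sum.cong) auto
    also have "\<dots> = (\<Sum>v\<in>V - \<tau>. if insert v \<tau> = \<sigma> then (-1) ^ below v \<tau> * c \<sigma> else 0)"
      using \<sigma> by (intro sum.mono_neutral_left) auto
    finally show "(\<Sum>v\<in>V - \<tau>. if insert v \<tau> = \<sigma> then (-1) ^ below v \<tau> * c \<sigma> else 0) =
      incidence \<tau> \<sigma> * c \<sigma>" by simp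
  qed
  finally show ?thesis .
qed

text \<open>The boundary of the cone over \<open>e\<close> with apex \<open>n\<close>. For
  \<open>e\<close> in \<open>E\<close> this triangle need not belong to \<open>S\<close>, but its
  edges do.\<close>

definition cone_cycle :: "nat set \<Rightarrow> nat set \<Rightarrow> int" where
  "cone_cycle e = (\<lambda>\<tau>\<in>faces S 1. incidence \<tau> (insert n e) mod m)"

text \<open>In the full simplex \<open>T\<close> the cone triangle is a face, so its boundary is a
  cycle by \<open>bd_bd\<close>. The cycle condition involves only edges, and these are the same in
  \<open>T\<close> and in \<open>S\<close>.\<close>

lemma cone_cycle_Z:
  assumes "e \<in> E"
  shows "cone_cycle e \<in> carrier Z"
proof -
  define T where "T = {\<sigma>. \<sigma> \<noteq> {} \<and> \<sigma> \<subseteq> V}"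
  interpret F: chain_complex n T m
  proof
    show "simplicial_complex_on V T"
      unfolding simplicial_complex_on_def T_def using finite_subset by auto
    show "\<sigma> \<in> T" if "\<sigma> \<subseteq> V" "card \<sigma> \<in> {1, 2}" for \<sigma>
      using that by (auto simp: T_def)
  qed (rule n, rule m)
  define \<sigma> where "\<sigma> = insert n e"
  have "\<sigma> \<subseteq> V"
    using assms n by (auto simp: \<sigma>_def base_edges_def)
  then have \<sigma>: "\<sigma> \<subseteq> V" "finite \<sigma>"
    using finite_subset[of \<sigma> V] by blast+
  have inc: "incidence \<tau> \<sigma> = F.bd (\<lambda>\<rho>. if \<rho> = \<sigma> then 1 else 0) \<tau>" if "\<tau> \<subseteq> V" for \<tau>
    unfolding incidence_def F.bd_def
    by (rule sum.mono_neutral_cong_left) (use \<sigma> that in \<open>auto simp: T_def\<close>)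
  have "bd (cone_cycle e) {a} mod m = 0" if a: "a \<in> V" for a
  proof -
    have edge: "{v, a} \<in> faces S 1" if "v \<in> V - {a}" for v
      using edge_in a that by auto
    have "bd (cone_cycle e) {a} mod m = bd (\<lambda>\<tau>. incidence \<tau> \<sigma>) {a} mod m"
      by (rule bd_cong_mod) (use edge in \<open>auto simp: cone_cycle_def \<sigma>_def\<close>)
    also have "bd (\<lambda>\<tau>. incidence \<tau> \<sigma>) {a} = F.bd (F.bd (\<lambda>\<rho>. if \<rho> = \<sigma> then 1 else 0)) {a}"
      unfolding bd_def F.bd_def[of "F.bd _"]
    proof (rule sum.cong[OF refl])
      fix v assume v: "v \<in> V - {a}"
      have "{v, a} \<in> S" "{v, a} \<in> T" "{v, a} \<subseteq> V"
        using edge[OF v] v a by (auto simp: faces_def T_def)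
      then show "(if {v, a} \<in> S then (-1) ^ below v {a} * incidence {v, a} \<sigma> else 0) =
          (if {v, a} \<in> T then (-1) ^ below v {a} * F.bd (\<lambda>\<rho>. if \<rho> = \<sigma> then 1 else 0) {v, a} else 0)"
        using inc by simp
    qed
    also have "\<dots> = 0" by (rule F.bd_bd)
    finally show ?thesis by simp
  qed
  moreover have "cone_cycle e \<in> carrier (chains R S 1)"
    unfolding cone_cycle_def carrier_chains R_simps by simp
  ultimately show ?thesis unfolding carrier_Z by blast
qed

lemma cone_cycle_base:
  assumes "e \<in> E" "\<tau> \<in> E" shows "cone_cycle e \<tau> = (if \<tau> = e then 1 else 0)"
proof -
  have "\<tau> \<in> faces S 1" using E_faces assms by blast
  moreover have "1 mod m = 1" using m by auto
  ultimately show ?thesis using assms by (simp add: cone_cycle_def incidence_cone)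
qed

definition combination :: "nat set set \<Rightarrow> (nat set \<Rightarrow> int) \<Rightarrow> nat set \<Rightarrow> int" where
  "combination X a = (\<lambda>\<tau>\<in>faces S 1. (\<Sum>e\<in>X. a e * cone_cycle e \<tau>) mod m)"

lemma combination_Z:
  assumes "X \<subseteq> E"
  shows "combination X a \<in> carrier Z"
proof -
  have "bd (combination X a) {v} mod m = 0" if v: "v \<in> V" for v
  proof -
    have "bd (combination X a) {v} mod m = bd (\<lambda>\<tau>. \<Sum>e\<in>X. a e * cone_cycle e \<tau>) {v} mod m"
      by (rule bd_cong_mod) (use edge_in v in \<open>auto simp: combination_def\<close>)
    also have "\<dots> = (\<Sum>e\<in>X. a e * bd (cone_cycle e) {v}) mod m"
      by (simp add: bd_sum bd_mult)
    also have "\<dots> = (\<Sum>e\<in>X. (a e * bd (cone_cycle e) {v}) mod m) mod m"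
      by (simp add: mod_sum_eq)
    also have "(\<Sum>e\<in>X. (a e * bd (cone_cycle e) {v}) mod m) = 0"
    proof (rule sum.neutral, rule ballI)
      fix e assume "e \<in> X"
      then have "bd (cone_cycle e) {v} mod m = 0"
        using cone_cycle_Z assms v by (auto simp: carrier_Z)
      then show "(a e * bd (cone_cycle e) {v}) mod m = 0"
        by (metis mod_0 mod_mult_right_eq mult_zero_right)
    qed
    finally show ?thesis by simp
  qed
  moreover have "combination X a \<in> carrier (chains R S 1)"
    unfolding combination_def carrier_chains R_simps by simp
  ultimately show ?thesis unfolding carrier_Z by blast
qed

lemma combination_base:
  assumes "X \<subseteq> E" "\<tau> \<in> X"
  shows "combination X a \<tau> = a \<tau> mod m"
proof -
  have fin: "finite X" using assms finite_base_edges finite_subset by blast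
  have "(\<Sum>e\<in>X. a e * cone_cycle e \<tau>) = (\<Sum>e\<in>X. if e = \<tau> then a e else 0)"
    using assms by (intro sum.cong) (auto simp: cone_cycle_base subset_iff)
  also have "\<dots> = a \<tau>" using fin assms(2) by simp
  finally show ?thesis using assms E_faces by (auto simp: combination_def)
qed

text \<open>Two cycles with the same values on \<open>E\<close> are equal. Hence the cone cycles
  generate all cycles, and the coordinates of a cycle are its values on \<open>E\<close>.\<close>

lemma cycle_eq_combination:
  assumes "c \<in> carrier Z"
  shows "c = combination E c"
proof (rule cycle_eqI[OF assms combination_Z])
  fix e assume e: "e \<in> E"
  then have "e \<in> faces S 1" using E_faces by blast
  then show "c e = combination E c e" using Z_val[OF assms] e by (simp add: combination_base)
qed simp

text \<open>A linear functional on cycles is determined by its values on the cone cycles. The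
  induction adds one edge at a time to the combination.\<close>

lemma functional_combination:
  assumes closed: "\<And>c. c \<in> carrier Z \<Longrightarrow> \<psi> c mod m = \<psi> c"
    and add: "\<And>c d. \<lbrakk>c \<in> carrier Z; d \<in> carrier Z\<rbrakk> \<Longrightarrow> \<psi> (c \<oplus>\<^bsub>Z\<^esub> d) = (\<psi> c + \<psi> d) mod m"
    and smult: "\<And>a c. \<lbrakk>a mod m = a; c \<in> carrier Z\<rbrakk> \<Longrightarrow> \<psi> (a \<odot>\<^bsub>Z\<^esub> c) = (a * \<psi> c) mod m"
    and c: "c \<in> carrier Z"
  shows "\<psi> c = (\<Sum>e\<in>E. c e * \<psi> (cone_cycle e)) mod m"
proof -
  interpret Z: module R Z by (rule Z_module)
  have "\<psi> (combination X c) = (\<Sum>e\<in>X. c e * \<psi> (cone_cycle e)) mod m" if "X \<subseteq> E" for X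
  proof -
    have "finite X" using that finite_base_edges finite_subset by blast
    then show ?thesis using that
    proof (induction X rule: finite_induct)
      case empty
      have "combination {} c = 0 \<odot>\<^bsub>Z\<^esub> c"
        by (simp add: combination_def Z_simps)
      then show ?case using smult[of 0 c] c by simp
    next
      case (insert e X)
      have e: "e \<in> E" "X \<subseteq> E" using insert.prems by auto
      have ce: "c e mod m = c e" using Z_val[OF c] e E_faces by blast
      have sm: "c e \<odot>\<^bsub>Z\<^esub> cone_cycle e \<in> carrier Z"
        using ce cone_cycle_Z[OF e(1)] by (intro Z.smult_closed) (simp_all add: R_simps)
      have "combination (insert e X) c = combination X c \<oplus>\<^bsub>Z\<^esub> (c e \<odot>\<^bsub>Z\<^esub> cone_cycle e)"
        unfolding combination_def Z_simps using insert.hyps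
        by (intro restrict_ext) (simp add: mod_add_eq add.commute)
      then have "\<psi> (combination (insert e X) c) =
          (\<psi> (combination X c) + \<psi> (c e \<odot>\<^bsub>Z\<^esub> cone_cycle e)) mod m"
        using add[OF combination_Z[OF e(2)] sm] by simp
      also have "\<dots> = ((\<Sum>e\<in>X. c e * \<psi> (cone_cycle e)) mod m + (c e * \<psi> (cone_cycle e)) mod m) mod m"
        using insert.IH e smult[OF ce cone_cycle_Z[OF e(1)]] by simp
      also have "\<dots> = (\<Sum>e\<in>insert e X. c e * \<psi> (cone_cycle e)) mod m"
        using insert.hyps by (simp add: mod_add_eq add.commute)
      finally show ?case .
    qed
  qed
  from this[of E] show ?thesis using cycle_eq_combination[OF c] by simp
qed

section \<open>Boundaries and homology classes\<close>

definition B :: "(nat set \<Rightarrow> int) set" where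
  "B = boundaries1 R S"

lemma boundary_base:
  assumes "x \<in> carrier (chains R S 2)" "e \<in> faces S 1"
  shows "boundary R S 1 x e = (\<Sum>\<sigma>\<in>faces S 2. incidence e \<sigma> * x \<sigma>) mod m"
proof -
  have x: "x \<in> carrier (chains R S (Suc 1))" using assms(1) by (simp add: numeral_2_eq_2)
  have "boundary R S 1 x e = bd x e mod m"
    unfolding boundary_eq[OF x] using assms(2) by simp
  then show ?thesis using bd_incidence[OF assms(2), of x] by (simp add: numeral_2_eq_2)
qed

lemma boundary_Z:
  assumes "x \<in> carrier (chains R S 2)"
  shows "boundary R S 1 x \<in> carrier Z"
proof -
  have x: "x \<in> carrier (chains R S (Suc 1))" using assms by (simp add: numeral_2_eq_2)
  have "bd (boundary R S 1 x) {a} mod m = bd (bd x) {a} mod m" if a: "a \<in> V" for a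
    unfolding boundary_eq[OF x]
    by (rule bd_cong_mod) (use edge_in a in \<open>auto simp: \<close>)
  then show ?thesis using boundary_closed[OF x] by (simp add: carrier_Z bd_bd)
qed

lemma B_submodule: "submodule R B Z"
proof -
  interpret h: mod_hom R "chains R S (Suc 1)" "chains R S 1" "boundary R S 1"
    by (rule boundary_hom)
  have B: "B = h.im"
    unfolding B_def boundaries1_def h.im_def by (simp add: numeral_2_eq_2)
  have sub: "submodule R B (chains R S 1)" unfolding B by (rule h.im_is_submodule)
  show ?thesis
  proof (rule submodule.intro[OF Z_module])
    show "B \<subseteq> carrier Z" using boundary_Z by (auto simp: B_def boundaries1_def)
    show "v \<oplus>\<^bsub>Z\<^esub> w \<in> B" if "v \<in> B" "w \<in> B" for v w
      using submodule.m_closed[OF sub that] by (simp add: Z_def cycles1_def)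
    show "c \<odot>\<^bsub>Z\<^esub> v \<in> B" if "c \<in> carrier R" "v \<in> B" for c v
      using submodule.smult_closed[OF sub that] by (simp add: Z_def cycles1_def)
    show "\<zero>\<^bsub>Z\<^esub> \<in> B" using submodule.zero_closed[OF sub] by (simp add: Z_def cycles1_def)
  qed
qed

lemma H1_eq: "H1 R S = quotient_module Z B"
  by (simp add: H1_def Z_def B_def)

text \<open>Being homologous can be tested on \<open>E\<close> alone, because the values of a cycle
  on the star at \<open>n\<close> follow from the others.\<close>

lemma coset_eqI:
  assumes c: "c \<in> carrier Z" and d: "d \<in> carrier Z" and x: "x \<in> carrier (chains R S 2)"
    and eq: "\<And>e. e \<in> E \<Longrightarrow> c e mod m = (boundary R S 1 x e + d e) mod m"
  shows "a_r_coset Z B c = a_r_coset Z B d"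
proof -
  interpret Z: module R Z by (rule Z_module)
  interpret B: abelian_subgroup B Z by (rule submodule_abelian_subgroup[OF B_submodule])
  have b: "boundary R S 1 x \<in> B" using x by (simp add: B_def boundaries1_def)
  have bZ: "boundary R S 1 x \<in> carrier Z" by (rule boundary_Z[OF x])
  have "c = boundary R S 1 x \<oplus>\<^bsub>Z\<^esub> d"
  proof (rule cycle_eqI[OF c Z.M.a_closed[OF bZ d]])
    fix e assume e: "e \<in> E"
    then have "e \<in> faces S 1" using E_faces by blast
    then show "c e = (boundary R S 1 x \<oplus>\<^bsub>Z\<^esub> d) e"
      using Z_val[OF c, of e] eq[OF e] unfolding Z_simps by simp
  qed
  then have "c \<in> a_r_coset Z B d" using b unfolding a_r_coset_def' by blast
  then show ?thesis using Z.M.a_repr_independence[OF _ d B.a_subgroup] by simp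
qed

section \<open>Homology with finite coefficients and normalised cocycles\<close>

lemma finite_carrier_H1:
  assumes "m \<noteq> 0"
  shows "finite (carrier (H1 R S))"
proof -
  have "carrier R \<subseteq> {0..<m}"
  proof
    fix x assume "x \<in> carrier R"
    then have "x mod m = x" unfolding R_simps by simp
    moreover have "m > 0" using m assms by auto
    ultimately show "x \<in> {0..<m}" by (metis atLeastLessThan_iff pos_mod_sign pos_mod_bound)
  qed
  then have "finite (carrier (chains R S 1))"
    unfolding carrier_chains using finite_faces finite_subset by (intro finite_PiE) blast+
  then have "finite (carrier Z)" unfolding carrier_Z by simp
  then show ?thesis unfolding H1_eq quotient_module_carrier by (rule finite_imageI)
qed

text \<open>For \<open>m > 0\<close> and extension by zero to the edges at \<open>n\<close>, these
  are the 1-cocycles normalised to vanish on a spanning tree, one for each cohomology class.\<close>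

definition cocycles :: "(nat set \<Rightarrow> int) set" where
  "cocycles = {f \<in> E \<rightarrow>\<^sub>E {0..<m}. \<forall>\<sigma>\<in>faces S 2. (\<Sum>e\<in>E. incidence e \<sigma> * f e) mod m = 0}"

text \<open>Pulled back to cycles, a functional on homology takes the same value at the boundary of
  a single triangle as at zero. Expressed through the cone cycles, this is the cocycle equation at
  that triangle.\<close>

lemma functional_cocycle:
  assumes "m \<noteq> 0"
    and \<phi>: "\<phi> \<in> carrier (H1 R S) \<rightarrow>\<^sub>E carrier R"
    and add: "\<And>v w. \<lbrakk>v \<in> carrier (H1 R S); w \<in> carrier (H1 R S)\<rbrakk> \<Longrightarrow>
      \<phi> (v \<oplus>\<^bsub>H1 R S\<^esub> w) = \<phi> v \<oplus>\<^bsub>R\<^esub> \<phi> w"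
    and smult: "\<And>r v. \<lbrakk>r \<in> carrier R; v \<in> carrier (H1 R S)\<rbrakk> \<Longrightarrow>
      \<phi> (r \<odot>\<^bsub>H1 R S\<^esub> v) = r \<otimes>\<^bsub>R\<^esub> \<phi> v"
  shows "c \<in> carrier Z \<Longrightarrow> \<phi> (a_r_coset Z B c) =
      (\<Sum>e\<in>E. c e * \<phi> (a_r_coset Z B (cone_cycle e))) mod m"
    and "(\<lambda>e\<in>E. \<phi> (a_r_coset Z B (cone_cycle e))) \<in> cocycles"
proof -
  interpret Z: module R Z by (rule Z_module)
  interpret B: abelian_subgroup B Z by (rule submodule_abelian_subgroup[OF B_submodule])
  note ops = quotient_module_ops[OF B_submodule, folded H1_eq]
  define \<psi> where "\<psi> c = \<phi> (a_r_coset Z B c)" for c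
  have coset: "a_r_coset Z B c \<in> carrier (H1 R S)" if "c \<in> carrier Z" for c
    using that unfolding H1_eq quotient_module_carrier by blast
  have \<psi>R: "\<psi> c \<in> carrier R" if "c \<in> carrier Z" for c
    unfolding \<psi>_def using \<phi> coset[OF that] by auto
  have comb: "\<psi> c = (\<Sum>e\<in>E. c e * \<psi> (cone_cycle e)) mod m" if "c \<in> carrier Z" for c
  proof (rule functional_combination[OF _ _ _ that])
    show "\<psi> c mod m = \<psi> c" if "c \<in> carrier Z" for c
      using \<psi>R[OF that] unfolding R_simps by simp
    show "\<psi> (c \<oplus>\<^bsub>Z\<^esub> d) = (\<psi> c + \<psi> d) mod m" if "c \<in> carrier Z" "d \<in> carrier Z" for c d
      unfolding \<psi>_def ops(2)[OF that, symmetric] add[OF coset[OF that(1)] coset[OF that(2)]] R_simps ..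
    show "\<psi> (a \<odot>\<^bsub>Z\<^esub> c) = (a * \<psi> c) mod m" if "a mod m = a" "c \<in> carrier Z" for a c
    proof -
      have a: "a \<in> carrier R" using that(1) unfolding R_simps by simp
      show ?thesis
        unfolding \<psi>_def ops(3)[OF a that(2), symmetric] smult[OF a coset[OF that(2)]] R_simps ..
    qed
  qed
  then show "\<phi> (a_r_coset Z B c) = (\<Sum>e\<in>E. c e * \<phi> (a_r_coset Z B (cone_cycle e))) mod m"
    if "c \<in> carrier Z" using that unfolding \<psi>_def by blast
  show "(\<lambda>e\<in>E. \<phi> (a_r_coset Z B (cone_cycle e))) \<in> cocycles"
    unfolding cocycles_def
  proof (intro CollectI conjI ballI)
    have "\<psi> (cone_cycle e) \<in> {0..<m}" if "e \<in> E" for e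
    proof -
      have "\<psi> (cone_cycle e) mod m = \<psi> (cone_cycle e)"
        using \<psi>R[OF cone_cycle_Z[OF that]] unfolding R_simps by simp
      moreover have "m > 0" using m assms(1) by auto
      ultimately show ?thesis by (metis atLeastLessThan_iff pos_mod_sign pos_mod_bound)
    qed
    then show "(\<lambda>e\<in>E. \<phi> (a_r_coset Z B (cone_cycle e))) \<in> E \<rightarrow>\<^sub>E {0..<m}"
      unfolding \<psi>_def by simp
  next
    fix \<sigma> assume \<sigma>: "\<sigma> \<in> faces S 2"
    define x where "x = (\<lambda>\<rho>\<in>faces S 2. if \<rho> = \<sigma> then 1 else (0 :: int))"
    have "1 mod m = 1" using m by auto
    then have x: "x \<in> carrier (chains R S 2)"
      unfolding x_def carrier_chains R_simps by simp
    have val: "boundary R S 1 x e = incidence e \<sigma> mod m" if "e \<in> E" for e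
    proof -
      have "(\<Sum>\<rho>\<in>faces S 2. incidence e \<rho> * x \<rho>) = (\<Sum>\<rho>\<in>faces S 2. if \<rho> = \<sigma> then incidence e \<rho> else 0)"
        unfolding x_def by (rule sum.cong) auto
      also have "\<dots> = incidence e \<sigma>" using \<sigma> finite_faces by simp
      finally show ?thesis using boundary_base[OF x] that E_faces by auto
    qed
    have zero: "\<zero>\<^bsub>Z\<^esub> \<in> carrier Z" by simp
    have "a_r_coset Z B (boundary R S 1 x) = a_r_coset Z B \<zero>\<^bsub>Z\<^esub>"
    proof (rule coset_eqI[OF boundary_Z[OF x] zero x])
      fix e assume "e \<in> E"
      then have "\<zero>\<^bsub>Z\<^esub> e = 0" using E_faces unfolding Z_simps by auto
      then show "boundary R S 1 x e mod m = (boundary R S 1 x e + \<zero>\<^bsub>Z\<^esub> e) mod m" by simp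
    qed
    then have "\<psi> (boundary R S 1 x) = \<psi> \<zero>\<^bsub>Z\<^esub>" by (simp add: \<psi>_def)
    also have "\<dots> = (\<Sum>e\<in>E. \<zero>\<^bsub>Z\<^esub> e * \<psi> (cone_cycle e)) mod m" by (rule comb[OF zero])
    also have "(\<Sum>e\<in>E. \<zero>\<^bsub>Z\<^esub> e * \<psi> (cone_cycle e)) = 0"
      using E_faces unfolding Z_simps by (intro sum.neutral) auto
    finally have "(\<Sum>e\<in>E. boundary R S 1 x e * \<psi> (cone_cycle e)) mod m = 0"
      using comb[OF boundary_Z[OF x]] by simp
    moreover have "(\<Sum>e\<in>E. boundary R S 1 x e * \<psi> (cone_cycle e)) mod m =
        (\<Sum>e\<in>E. incidence e \<sigma> * \<psi> (cone_cycle e)) mod m"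
    proof -
      have "(\<Sum>e\<in>E. boundary R S 1 x e * \<psi> (cone_cycle e)) mod m =
          (\<Sum>e\<in>E. (boundary R S 1 x e * \<psi> (cone_cycle e)) mod m) mod m"
        by (simp add: mod_sum_eq)
      also have "(\<Sum>e\<in>E. (boundary R S 1 x e * \<psi> (cone_cycle e)) mod m) =
          (\<Sum>e\<in>E. (incidence e \<sigma> * \<psi> (cone_cycle e)) mod m)"
        by (rule sum.cong) (simp_all add: val mod_mult_left_eq del: One_nat_def)
      finally show ?thesis by (simp add: mod_sum_eq)
    qed
    ultimately show "(\<Sum>e\<in>E. incidence e \<sigma> * (\<lambda>e\<in>E. \<phi> (a_r_coset Z B (cone_cycle e))) e) mod m = 0"
      unfolding \<psi>_def by (simp cong: sum.cong)
  qed
qed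

text \<open>The left side counts the functionals on \<open>H1 R S\<close>. Evaluation at the cone
  cycles maps them to cocycles, injectively since the cone cycles generate.\<close>

lemma power_dim_H1_le:
  assumes "prime m"
  shows "nat m ^ vectorspace.dim R (H1 R S) \<le> card cocycles"
proof -
  have m0: "m \<noteq> 0" and m1: "m > 1" using assms prime_gt_1_int[OF assms] by auto
  interpret residues_prime "nat m" "residue_ring (int (nat m))"
    by unfold_locales (use assms m1 in \<open>auto simp: prime_nat_iff_prime\<close>)
  have R: "R = residue_ring (int (nat m))" using m1 by (simp add: coeff_ring_def)
  have field: "field R" using is_field R by simp
  have card_R: "finite (carrier R)" "card (carrier R) = nat m"
    unfolding R using m1 by (simp_all add: residue_ring_def)
  interpret V: vectorspace R "H1 R S"
    unfolding H1_eq
    by (intro vectorspace.intro quotient_module_is_module B_submodule field)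
  have "V.span (carrier (H1 R S)) = carrier (H1 R S)"
    using V.in_own_span[of "carrier (H1 R S)"] V.span_closed[of "carrier (H1 R S)"] by blast
  then have "V.fin_dim"
    unfolding V.fin_dim_def using finite_carrier_H1[OF m0] by blast
  then obtain \<Phi> where \<Phi>: "finite \<Phi>" "card \<Phi> = card (carrier R) ^ V.dim"
    "\<And>\<phi>. \<phi> \<in> \<Phi> \<Longrightarrow> \<phi> \<in> carrier (H1 R S) \<rightarrow>\<^sub>E carrier R"
    "\<And>\<phi> v w. \<lbrakk>\<phi> \<in> \<Phi>; v \<in> carrier (H1 R S); w \<in> carrier (H1 R S)\<rbrakk> \<Longrightarrow>
      \<phi> (v \<oplus>\<^bsub>H1 R S\<^esub> w) = \<phi> v \<oplus>\<^bsub>R\<^esub> \<phi> w"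
    "\<And>\<phi> r v. \<lbrakk>\<phi> \<in> \<Phi>; r \<in> carrier R; v \<in> carrier (H1 R S)\<rbrakk> \<Longrightarrow>
      \<phi> (r \<odot>\<^bsub>H1 R S\<^esub> v) = r \<otimes>\<^bsub>R\<^esub> \<phi> v"
    using V.card_functionals[OF _ card_R(1)] by blast
  define g where "g \<phi> = (\<lambda>e\<in>E. \<phi> (a_r_coset Z B (cone_cycle e)))" for \<phi> :: "(nat set \<Rightarrow> int) set \<Rightarrow> int"
  have fc: "\<phi> (a_r_coset Z B c) = (\<Sum>e\<in>E. c e * \<phi> (a_r_coset Z B (cone_cycle e))) mod m"
    if "\<phi> \<in> \<Phi>" "c \<in> carrier Z" for \<phi> c
    using functional_cocycle(1)[OF m0 \<Phi>(3)[OF that(1)] \<Phi>(4)[OF that(1)] \<Phi>(5)[OF that(1)]] that(2)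
    by blast
  have g_cocycle: "g \<phi> \<in> cocycles" if "\<phi> \<in> \<Phi>" for \<phi>
    using functional_cocycle(2)[OF m0 \<Phi>(3)[OF that(1)] \<Phi>(4)[OF that(1)] \<Phi>(5)[OF that(1)]]
    unfolding g_def by blast
  have "inj_on g \<Phi>"
  proof (rule inj_onI)
    fix \<phi> \<phi>' assume \<phi>: "\<phi> \<in> \<Phi>" "\<phi>' \<in> \<Phi>" and eq: "g \<phi> = g \<phi>'"
    show "\<phi> = \<phi>'"
    proof (rule PiE_ext[OF \<Phi>(3)[OF \<phi>(1)] \<Phi>(3)[OF \<phi>(2)]])
      fix v assume "v \<in> carrier (H1 R S)"
      then obtain c where c: "c \<in> carrier Z" "v = a_r_coset Z B c"
        unfolding H1_eq quotient_module_carrier by blast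
      have "\<phi> (a_r_coset Z B (cone_cycle e)) = \<phi>' (a_r_coset Z B (cone_cycle e))" if "e \<in> E" for e
        using fun_cong[OF eq, of e] that by (simp add: g_def)
      then show "\<phi> v = \<phi>' v"
        unfolding c(2) fc[OF \<phi>(1) c(1)] fc[OF \<phi>(2) c(1)]
        by (simp cong: sum.cong)
    qed
  qed
  moreover have "g ` \<Phi> \<subseteq> cocycles"
    using g_cocycle by blast
  moreover have "finite cocycles"
    unfolding cocycles_def using finite_base_edges by (simp add: finite_PiE)
  ultimately have "card \<Phi> \<le> card cocycles" by (rule card_inj_on_le)
  then show ?thesis using \<Phi>(2) card_R(2) by simp
qed

section \<open>Integral homology and the reduced boundary matrix\<close>

context
  fixes es cs :: "nat set list" and A :: "int mat"
  assumes m0: "m = 0" and es: "distinct es" "set es = E"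
    and cs: "distinct cs" "set cs = faces S 2" "length cs = length es"
  defines "A \<equiv> Matrix.mat (length es) (length es) (\<lambda>(i, j). incidence (es ! i) (cs ! j))"
begin

lemma A_carrier: "A \<in> carrier_mat (length es) (length es)"
  by (simp add: A_def)

lemma chains_UNIV: "carrier (chains R S k) = faces S k \<rightarrow>\<^sub>E UNIV"
  unfolding carrier_chains R_simps using m0 by simp

lemma boundary_vec:
  assumes x: "x \<in> carrier (chains R S 2)" and i: "i < length es"
  shows "boundary R S 1 x (es ! i) = (\<Sum>j<length es. A $$ (i, j) * x (cs ! j))"
proof -
  have "es ! i \<in> faces S 1" using E_faces es(2) i nth_mem by blast
  then have "boundary R S 1 x (es ! i) = (\<Sum>\<sigma>\<in>faces S 2. incidence (es ! i) \<sigma> * x \<sigma>)"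
    using boundary_base[OF x] m0 by simp
  also have "\<dots> = (\<Sum>j<length es. incidence (es ! i) (cs ! j) * x (cs ! j))"
    using sum.reindex_bij_betw[OF bij_betw_nth[OF cs(1) refl cs(2)[symmetric]],
        of "\<lambda>\<sigma>. incidence (es ! i) \<sigma> * x \<sigma>"] cs(3) by simp
  also have "\<dots> = (\<Sum>j<length es. A $$ (i, j) * x (cs ! j))"
    using i by (intro sum.cong) (auto simp: A_def)
  finally show ?thesis .
qed

text \<open>A nonzero integer vector \<open>y\<close> in the left kernel defines a functional that
  kills all boundaries. It separates the multiples \<open>w k\<close> of a cone cycle at an edge
  where \<open>y\<close> is nonzero, so there would be infinitely many classes.\<close>

lemma det_nonzero:
  assumes "finite (carrier (H1 R S))"
  shows "Determinant.det A \<noteq> 0"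
proof
  assume "Determinant.det A = 0"
  then have "Determinant.det (transpose_mat A) = 0" using det_transpose[OF A_carrier] by simp
  then obtain y where y: "y \<in> carrier_vec (length es)" "y \<noteq> 0\<^sub>v (length es)"
    "transpose_mat A *\<^sub>v y = 0\<^sub>v (length es)"
    using det_0_iff_vec_prod_zero[of "transpose_mat A" "length es"] A_carrier by auto
  obtain i0 where i0: "i0 < length es" "vec_index y i0 \<noteq> 0"
  proof -
    have "\<exists>i<length es. vec_index y i \<noteq> 0"
    proof (rule ccontr)
      assume "\<not> ?thesis"
      then have "y = 0\<^sub>v (length es)" using y(1) by (intro eq_vecI) auto
      then show False using y(2) by simp
    qed
    then show thesis using that by blast
  qed
  define \<phi> where "\<phi> c = (\<Sum>i<length es. vec_index y i * c (es ! i))" for c :: "nat set \<Rightarrow> int"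
  have column: "(\<Sum>i<length es. vec_index y i * A $$ (i, j)) = 0" if j: "j < length es" for j
  proof -
    have "vec_index (transpose_mat A *\<^sub>v y) j = (\<Sum>i<length es. A $$ (i, j) * vec_index y i)"
      using j y(1) A_carrier by (simp add: scalar_prod_def atLeast0LessThan)
    then show ?thesis using y(3) j by (simp add: mult.commute)
  qed
  have \<phi>_boundary: "\<phi> b = 0" if "b \<in> B" for b
  proof -
    obtain x where x: "x \<in> carrier (chains R S 2)" "b = boundary R S 1 x"
      using \<open>b \<in> B\<close> unfolding B_def boundaries1_def by blast
    have "\<phi> b = (\<Sum>i<length es. \<Sum>j<length es. vec_index y i * A $$ (i, j) * x (cs ! j))"
      unfolding \<phi>_def x(2)
      by (intro sum.cong refl) (simp add: boundary_vec[OF x(1)] sum_distrib_left mult.assoc del: One_nat_def)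
    also have "\<dots> = (\<Sum>j<length es. (\<Sum>i<length es. vec_index y i * A $$ (i, j)) * x (cs ! j))"
      by (subst sum.swap) (simp add: sum_distrib_right)
    also have "\<dots> = 0" using column by simp
    finally show ?thesis .
  qed
  define e0 where "e0 = es ! i0"
  have e0: "e0 \<in> E" using es(2) i0(1) nth_mem unfolding e0_def by blast
  define w where "w k = combination {e0} (\<lambda>_. k)" for k
  have w: "w k \<in> carrier Z" for k unfolding w_def using e0 by (intro combination_Z) simp
  have w_val: "w k e = (if e = e0 then k else 0)" if "e \<in> E" for k e
  proof -
    have "e \<in> faces S 1" using that E_faces by blast
    then have "w k e = (k * cone_cycle e0 e) mod m" by (simp add: w_def combination_def)
    moreover have "x mod m = x" for x using m0 by simp
    ultimately show ?thesis using cone_cycle_base[OF e0 that] by simp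
  qed
  have \<phi>_w: "\<phi> (w k) = vec_index y i0 * k" for k
  proof -
    have "\<phi> (w k) = (\<Sum>i<length es. if i = i0 then vec_index y i * k else 0)"
      unfolding \<phi>_def
    proof (rule sum.cong[OF refl])
      fix i assume "i \<in> {..<length es}"
      then have "es ! i \<in> E" "es ! i = e0 \<longleftrightarrow> i = i0"
        using es i0(1) nth_mem unfolding e0_def by (auto simp: nth_eq_iff_index_eq)
      then show "vec_index y i * w k (es ! i) = (if i = i0 then vec_index y i * k else 0)"
        by (simp add: w_val)
    qed
    then show ?thesis using i0(1) by simp
  qed
  interpret Z: module R Z by (rule Z_module)
  interpret B: abelian_subgroup B Z by (rule submodule_abelian_subgroup[OF B_submodule])
  have "inj (\<lambda>k. a_r_coset Z B (w k))"
  proof (rule injI)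
    fix k l assume eq: "a_r_coset Z B (w k) = a_r_coset Z B (w l)"
    have "w k \<in> a_r_coset Z B (w l)" unfolding eq[symmetric] by (rule B.a_rcos_self[OF w])
    then obtain b where b: "b \<in> B" "w k = b \<oplus>\<^bsub>Z\<^esub> w l" unfolding a_r_coset_def' by blast
    have "w k (es ! i) = b (es ! i) + w l (es ! i)" if "i < length es" for i
    proof -
      have "es ! i \<in> faces S 1" using E_faces es(2) that nth_mem by blast
      then show ?thesis unfolding b(2) Z_simps using m0 by simp
    qed
    then have "\<phi> (w k) = \<phi> b + \<phi> (w l)"
      unfolding \<phi>_def sum.distrib[symmetric] by (intro sum.cong) (auto simp: algebra_simps)
    then show "k = l" using \<phi>_boundary[OF b(1)] \<phi>_w i0(2) by simp
  qed
  then have "infinite (range (\<lambda>k. a_r_coset Z B (w k)))"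
    using infinite_UNIV_int finite_imageD by blast
  moreover have "range (\<lambda>k. a_r_coset Z B (w k)) \<subseteq> carrier (H1 R S)"
    using w unfolding H1_eq quotient_module_carrier by blast
  ultimately show False using assms finite_subset by blast
qed

text \<open>Restriction to \<open>E\<close> identifies integral cycles with integer vectors and
  boundaries with the column lattice of \<open>A\<close>. Hence cycles with the same representative
  in \<open>Q\<close> are homologous.\<close>

lemma card_H1_le_det:
  assumes "finite (carrier (H1 R S))"
  shows "card (carrier (H1 R S)) \<le> nat \<bar>Determinant.det A\<bar>"
proof -
  obtain Q where Q: "finite Q" "card Q \<le> nat \<bar>Determinant.det A\<bar>"
    "\<And>v. v \<in> carrier_vec (length es) \<Longrightarrow> \<exists>r\<in>Q. \<exists>x\<in>carrier_vec (length es). v = r + A *\<^sub>v x"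
    using lattice_index_le_det[OF A_carrier det_nonzero[OF assms]] A_carrier
    unfolding lattice_index_le_def by auto
  define vals where "vals c = Matrix.vec (length es) (\<lambda>i. c (es ! i))" for c :: "nat set \<Rightarrow> int"
  define P where "P r c \<longleftrightarrow> c \<in> carrier Z \<and> (\<exists>x\<in>carrier_vec (length es). vals c = r + A *\<^sub>v x)" for r c
  have same: "a_r_coset Z B c = a_r_coset Z B d" if c: "P r c" and d: "P r d" for r c d
  proof -
    obtain x y where x: "x \<in> carrier_vec (length es)" "vals c = r + A *\<^sub>v x"
      and y: "y \<in> carrier_vec (length es)" "vals d = r + A *\<^sub>v y"
      using c d unfolding P_def by blast
    define ix where "ix = inv_into {..<length cs} (\<lambda>j. cs ! j)"
    have ix: "ix (cs ! j) = j" if "j < length es" for j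
      unfolding ix_def using that cs(1,3) bij_betw_nth[OF cs(1) refl refl]
      by (intro inv_into_f_f) (auto simp: bij_betw_def)
    \<comment> \<open>The difference of the two coefficient vectors, read as a chain, has boundary
      \<open>c - d\<close> on \<open>E\<close>.\<close>
    define z where "z = (\<lambda>\<sigma>\<in>faces S 2. vec_index x (ix \<sigma>) - vec_index y (ix \<sigma>))"
    have z: "z \<in> carrier (chains R S 2)" unfolding z_def chains_UNIV by simp
    show ?thesis
    proof (rule coset_eqI[OF _ _ z])
      show "c \<in> carrier Z" "d \<in> carrier Z" using c d by (simp_all add: P_def)
      fix e assume "e \<in> E"
      then obtain i where i: "i < length es" "e = es ! i" using es(2) by (metis in_set_conv_nth)
      have val: "vec_index (r + A *\<^sub>v u) i =
          vec_index r i + (\<Sum>j<length es. A $$ (i, j) * vec_index u j)"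
        if "u \<in> carrier_vec (length es)" for u
        using i(1) A_carrier that by (simp add: scalar_prod_def atLeast0LessThan)
      have ce: "c e = vec_index r i + (\<Sum>j<length es. A $$ (i, j) * vec_index x j)"
        using val[OF x(1)] i unfolding x(2)[symmetric] by (simp add: vals_def)
      have de: "d e = vec_index r i + (\<Sum>j<length es. A $$ (i, j) * vec_index y j)"
        using val[OF y(1)] i unfolding y(2)[symmetric] by (simp add: vals_def)
      have "boundary R S 1 z e =
          (\<Sum>j<length es. A $$ (i, j) * (vec_index x j - vec_index y j))"
        unfolding i(2) boundary_vec[OF z i(1)]
      proof (rule sum.cong[OF refl])
        fix j assume j: "j \<in> {..<length es}"
        then have "cs ! j \<in> faces S 2" using cs(2,3) nth_mem by (metis lessThan_iff)
        then show "A $$ (i, j) * z (cs ! j) = A $$ (i, j) * (vec_index x j - vec_index y j)"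
          using ix j by (simp add: z_def)
      qed
      then have "c e = boundary R S 1 z e + d e"
        unfolding ce de by (simp add: sum_subtractf right_diff_distrib)
      then show "c e mod m = (boundary R S 1 z e + d e) mod m" by simp
    qed
  qed
  \<comment> \<open>\<open>SOME\<close> chooses one cycle for each representative; its value is
    arbitrary at representatives that belong to no cycle.\<close>
  have "carrier (H1 R S) \<subseteq> (\<lambda>r. a_r_coset Z B (SOME c. P r c)) ` Q"
  proof
    fix v assume "v \<in> carrier (H1 R S)"
    then obtain c where c: "c \<in> carrier Z" "v = a_r_coset Z B c"
      unfolding H1_eq quotient_module_carrier by blast
    have "vals c \<in> carrier_vec (length es)" by (simp add: vals_def)
    then obtain r where r: "r \<in> Q" "P r c" using Q(3) c(1) unfolding P_def by blast
    have "P r (SOME c. P r c)" using someI_ex[of "P r"] r(2) by blast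
    then have "v = a_r_coset Z B (SOME c. P r c)"
      unfolding c(2) by (rule same[OF r(2)])
    then show "v \<in> (\<lambda>r. a_r_coset Z B (SOME c. P r c)) ` Q" using r(1) by blast
  qed
  then have "card (carrier (H1 R S)) \<le> card Q" by (rule surj_card_le[OF Q(1)])
  then show ?thesis using Q(2) by simp
qed

end

end

section \<open>The expected number of cocycles\<close>

lemma incidence_insert: "v \<notin> e \<Longrightarrow> incidence e (insert v e) = (-1) ^ below v e"
proof -
  assume "v \<notin> e"
  then have "insert v e - e = {v}" by auto
  then show ?thesis by (simp add: incidence_def)
qed

lemma incidence_nonzeroD:
  assumes "incidence e \<sigma> \<noteq> 0"
  obtains v where "v \<notin> e" "\<sigma> = insert v e"
proof -
  have "\<exists>v\<in>\<sigma> - e. insert v e = \<sigma>"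
  proof (rule ccontr)
    assume "\<not> ?thesis"
    then have "incidence e \<sigma> = 0" unfolding incidence_def by (intro sum.neutral) auto
    then show False using assms by simp
  qed
  then show thesis using that by blast
qed

lemma incidence_square: "incidence e \<sigma> \<noteq> 0 \<Longrightarrow> (incidence e \<sigma>)\<^sup>2 = 1"
proof -
  assume "incidence e \<sigma> \<noteq> 0"
  then obtain v where "v \<notin> e" "\<sigma> = insert v e" by (rule incidence_nonzeroD)
  then show ?thesis by (simp add: incidence_insert flip: power_mult)
qed

definition cocycle_on :: "nat \<Rightarrow> nat \<Rightarrow> (nat set \<Rightarrow> int) \<Rightarrow> nat set \<Rightarrow> bool" where
  "cocycle_on n p f \<sigma> \<longleftrightarrow> (\<Sum>e\<in>base_edges n. incidence e \<sigma> * f e) mod int p = 0"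

text \<open>The value on \<open>e\<close> that is forced by the cocycle condition on the triangle \<open>e \<union> {z}\<close>. The
  value \<open>p\<close> for \<open>z \<in> e\<close> is out of range and never matches.\<close>

definition forced_value :: "nat \<Rightarrow> nat \<Rightarrow> (nat set \<Rightarrow> int) \<Rightarrow> nat set \<Rightarrow> nat \<Rightarrow> int" where
  "forced_value n p f e z = (if z \<in> e then int p else
     (- incidence e (insert z e) *
       (\<Sum>e'\<in>base_edges n - {e}. incidence e' (insert z e) * f e')) mod int p)"

text \<open>The coefficient of \<open>f e\<close> in the cocycle equation is a sign and hence its
  own inverse, so the equation can be solved for \<open>f e\<close> modulo \<open>p\<close>; the
  range of \<open>f e\<close> removes the ambiguity.\<close>

lemma forced_value_eq:
  assumes e: "e \<in> base_edges n" and z: "z \<notin> e" and f: "f e \<in> {0..<int p}"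
    and cocycle: "cocycle_on n p f (insert z e)"
  shows "forced_value n p f e z = f e"
proof -
  define s where "s = incidence e (insert z e)"
  define r where "r = (\<Sum>e'\<in>base_edges n - {e}. incidence e' (insert z e) * f e')"
  have "s \<noteq> 0" unfolding s_def using z by (simp add: incidence_insert)
  then have s2: "s * s = 1" using incidence_square[of e "insert z e"] by (simp add: s_def power2_eq_square)
  have "(s * f e + r) mod int p = 0"
    using cocycle sum.remove[OF finite_base_edges e, of "\<lambda>e'. incidence e' (insert z e) * f e'"]
    by (simp add: cocycle_on_def s_def r_def)
  then have "int p dvd s * f e + r" by (simp add: mod_eq_0_iff_dvd)
  then have "int p dvd - s * (s * f e + r)" by (rule dvd_mult)
  also have "- s * (s * f e + r) = - s * r - (s * s) * f e" by (simp add: algebra_simps)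
  finally have "int p dvd - s * r - f e" by (simp add: s2)
  then have "(- s * r) mod int p = f e mod int p" by (simp add: mod_eq_dvd_iff)
  also have "f e mod int p = f e" using f by simp
  finally show ?thesis using z by (simp add: forced_value_def s_def r_def)
qed

text \<open>An edge of \<open>insert z e\<close> that misses \<open>z\<close> is a two-element
  subset of \<open>e\<close>, hence \<open>e\<close> itself. Fixing \<open>f\<close> on the edges at
  a sampled vertex therefore fixes all values forced there.\<close>

lemma forced_value_local:
  assumes e: "e \<in> base_edges n"
    and agree: "\<And>x. x \<in> {x \<in> base_edges n. z \<in> x} \<Longrightarrow> f x = f' x"
  shows "forced_value n p f e z = forced_value n p f' e z"
proof -
  have "incidence e' (insert z e) * f e' = incidence e' (insert z e) * f' e'"
    if e': "e' \<in> base_edges n - {e}" for e'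
  proof (cases "incidence e' (insert z e) = 0")
    case False
    then obtain v where v: "v \<notin> e'" "insert z e = insert v e'" by (rule incidence_nonzeroD)
    have "z \<in> e'"
    proof (rule ccontr)
      assume "z \<notin> e'"
      moreover have "e' \<subseteq> insert z e" unfolding v(2) by blast
      ultimately have "e' \<subseteq> e" by (simp add: subset_insert)
      moreover have "finite e" "card e' = card e" using e e' by (auto simp: base_edges_def intro: finite_subset)
      ultimately show False using e' card_subset_eq by blast
    qed
    then show ?thesis using agree e' by simp
  qed simp
  then have "(\<Sum>e'\<in>base_edges n - {e}. incidence e' (insert z e) * f e') =
      (\<Sum>e'\<in>base_edges n - {e}. incidence e' (insert z e) * f' e')"
    by (intro sum.cong refl)
  then show ?thesis by (simp only: forced_value_def)
qed

text \<open>Each square is zero or one, so the sum counts the triangles \<open>h j\<close>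
  containing \<open>e\<close>. Such a triangle is \<open>insert v e\<close> for a vertex
  \<open>v\<close> that forces the actual value, and distinct triangles have distinct
  \<open>v\<close>.\<close>

lemma sum_incidence_square_le:
  assumes h: "inj_on h J" "finite J" and J: "\<And>j. j \<in> J \<Longrightarrow> h j \<subseteq> {1..n} \<and> cocycle_on n p f (h j)"
    and e: "e \<in> base_edges n" and f: "f e \<in> {0..<int p}"
  shows "(\<Sum>j\<in>J. (incidence e (h j))\<^sup>2) \<le> int (card {z\<in>{1..n}. forced_value n p f e z = f e})"
proof -
  define I where "I = {j \<in> J. incidence e (h j) \<noteq> 0}"
  let ?Z = "{z\<in>{1..n}. forced_value n p f e z = f e}"
  have "(\<Sum>j\<in>J. (incidence e (h j))\<^sup>2) = (\<Sum>j\<in>I. (incidence e (h j))\<^sup>2)"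
    unfolding I_def using h(2) by (intro sum.mono_neutral_right) auto
  also have "\<dots> = (\<Sum>j\<in>I. 1)"
    by (intro sum.cong refl incidence_square) (simp add: I_def)
  also have "\<dots> = int (card I)" by simp
  also have "card I \<le> card ?Z"
  proof (rule surj_card_le)
    show "I \<subseteq> (\<lambda>z. inv_into J h (insert z e)) ` ?Z"
    proof
      fix j assume j: "j \<in> I"
      then have jJ: "j \<in> J" by (simp add: I_def)
      obtain v where v: "v \<notin> e" "h j = insert v e"
        using j by (auto simp: I_def elim: incidence_nonzeroD)
      have "v \<in> ?Z" using J[OF jJ] v e f by (auto intro!: forced_value_eq)
      moreover have "inv_into J h (insert v e) = j" using h(1) jJ v(2) by (metis inv_into_f_f)
      ultimately show "j \<in> (\<lambda>z. inv_into J h (insert z e)) ` ?Z" by blast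
    qed
  qed simp
  finally show ?thesis by simp
qed

lemma card_base_edges: "card (base_edges n) = (n - 1) choose 2"
  unfolding base_edges_def using n_subsets[of "{1..<n}" 2] by simp

lemma sum_prod_forced_value_le:
  assumes "n \<ge> 1" "p \<ge> 1" "k \<ge> 1"
  shows "(\<Sum>f\<in>base_edges n \<rightarrow>\<^sub>E {0..<int p}. \<Prod>e\<in>base_edges n.
      real (card {z\<in>{1..n}. forced_value n p f e z = f e})) \<le>
    real n ^ (k + (n - 1 choose 2)) * real p ^ (k * n) * (1 + real p / real k) ^ (n - 1 choose 2)"
proof -
  have "(\<Sum>f\<in>base_edges n \<rightarrow>\<^sub>E {0..<int p}. \<Prod>e\<in>base_edges n.
      real (card {z\<in>{1..n}. forced_value n p f e z = f e})) \<le>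
    real (card {1..n}) ^ (k + card (base_edges n)) * real (card {0..<int p}) ^ (k * n) *
      (1 + real (card {0..<int p}) / real k) ^ card (base_edges n)"
  proof (rule sum_PiE_prod_card_le[where inc = "\<lambda>z. {x \<in> base_edges n. z \<in> x}"])
    show "card {x \<in> base_edges n. z \<in> x} \<le> n" for z
    proof -
      have "{x \<in> base_edges n. z \<in> x} \<subseteq> (\<lambda>u. {z, u}) ` {1..n}"
      proof
        fix x assume x: "x \<in> {x \<in> base_edges n. z \<in> x}"
        then have "card (x - {z}) = 1" by (simp add: base_edges_def)
        then obtain u where u: "x - {z} = {u}" by (auto simp: card_1_singleton_iff)
        then have "x = {z, u}" "u \<in> x" using x by auto
        then show "x \<in> (\<lambda>u. {z, u}) ` {1..n}" using x by (auto simp: base_edges_def)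
      qed
      then have "card {x \<in> base_edges n. z \<in> x} \<le> card {1..n}" by (intro surj_card_le) auto
      then show ?thesis by simp
    qed
    show "forced_value n p f e z = forced_value n p f' e z"
      if "e \<in> base_edges n" "\<And>x. x \<in> {x \<in> base_edges n. z \<in> x} \<Longrightarrow> f x = f' x" for f f' e z
      using that by (rule forced_value_local)
  qed (use assms finite_base_edges in auto)
  then show ?thesis by (simp add: card_base_edges)
qed

section \<open>Application to hypertrees\<close>

lemma hypertree_chain_complex:
  assumes "hypertree n S" "n \<ge> 1" "m = 0 \<or> m > 1"
  shows "chain_complex n S m"
  using assms unfolding hypertree_def by (intro chain_complex.intro) blast+

lemma hypertree_simplex:
  assumes "hypertree n S" "\<sigma> \<in> S"
  shows "\<sigma> \<noteq> {}" "finite \<sigma>" "\<sigma> \<subseteq> {1..n}" "card \<sigma> \<le> 3"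
  using assms unfolding hypertree_def simplicial_complex_on_def by blast+

lemma finite_hypertrees: "finite {S. hypertree n S}"
proof (rule finite_subset)
  show "{S. hypertree n S} \<subseteq> Pow (Pow {1..n})" using hypertree_simplex(3) by blast
qed simp

text \<open>The 1-skeleton is complete and no simplex has more than three vertices, so only the
  choice of triangles is left.\<close>

lemma hypertree_eqI:
  assumes S: "hypertree n S" and S': "hypertree n S'" and eq: "faces S 2 = faces S' 2"
  shows "S = S'"
proof -
  have "S \<subseteq> S'" if S: "hypertree n S" and S': "hypertree n S'" and eq: "faces S 2 = faces S' 2" for S S'
  proof
    fix \<sigma> assume \<sigma>: "\<sigma> \<in> S"
    then have "\<sigma> \<noteq> {}" "finite \<sigma>" "\<sigma> \<subseteq> {1..n}" "card \<sigma> \<le> 3"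
      using hypertree_simplex[OF S \<sigma>] by blast+
    moreover from this have "card \<sigma> \<noteq> 0" by simp
    ultimately consider "card \<sigma> \<in> {1, 2}" | "card \<sigma> = 3" by force
    then show "\<sigma> \<in> S'"
    proof cases
      case 1
      then show ?thesis using S' \<open>\<sigma> \<subseteq> {1..n}\<close> unfolding hypertree_def by blast
    next
      case 2
      then have "\<sigma> \<in> faces S 2" using \<sigma> by (simp add: faces_def)
      then show ?thesis unfolding eq by (simp add: faces_def)
    qed
  qed
  from this[OF S S' eq] this[OF S' S eq[symmetric]] show ?thesis by blast
qed

lemma power_dim_H1_mod_le:
  assumes "hypertree n S" "n \<ge> 1" "prime p"
  shows "p ^ dim_H1_mod p S \<le> card {f \<in> base_edges n \<rightarrow>\<^sub>E {0..<int p}. \<forall>\<sigma>\<in>faces S 2. cocycle_on n p f \<sigma>}"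
proof -
  have p: "int p > 1" "prime (int p)" using assms(3) prime_gt_1_nat by auto
  interpret chain_complex n S "int p"
    using hypertree_chain_complex assms(1,2) p(1) by blast
  have "R = residue_ring (int p)" using p(1) by (simp add: coeff_ring_def)
  then show ?thesis
    using power_dim_H1_le[OF p(2)] by (simp add: dim_H1_mod_def cocycles_def cocycle_on_def)
qed

text \<open>The signs of \<open>wedge\<close> require a linear order on the columns, so the
  triangles are indexed through the bijection \<open>h\<close> from an ordered set.\<close>

lemma card_H1_le_wedge:
  assumes S: "hypertree n S" "n \<ge> 1" and es: "distinct es" "set es = base_edges n"
    and h: "bij_betw h J {\<sigma>. \<sigma> \<subseteq> {1..n} \<and> card \<sigma> = 3}" "finite J"
  shows "int (card (carrier (H1 int_ring S))) \<le>
    \<bar>wedge (map (\<lambda>e j. incidence e (h j)) es) {j\<in>J. h j \<in> faces S 2}\<bar>"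
proof -
  interpret chain_complex n S 0
    using hypertree_chain_complex S by blast
  have R: "R = int_ring" by (simp add: coeff_ring_def)
  define C where "C = {j\<in>J. h j \<in> faces S 2}"
  have faces: "faces S 2 \<subseteq> {\<sigma>. \<sigma> \<subseteq> {1..n} \<and> card \<sigma> = 3}"
    using simplex_subset by (auto simp: faces_def)
  have inj: "inj_on h J" and img: "h ` J = {\<sigma>. \<sigma> \<subseteq> {1..n} \<and> card \<sigma> = 3}"
    using h(1) by (auto simp: bij_betw_def)
  have "h ` C = h ` J \<inter> faces S 2" by (auto simp: C_def)
  also have "\<dots> = faces S 2" unfolding img using faces by (rule Int_absorb1)
  finally have "h ` C = faces S 2" .
  then have C: "finite C" "inj_on h C" "h ` C = faces S 2"
    using h(2) inj by (auto simp: C_def intro: inj_on_subset)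
  have len_es: "length es = (n - 1) choose 2"
    using distinct_card[OF es(1)] es(2) card_base_edges by simp
  have card_C: "card C = length es"
    using card_image[OF C(2)] C(3) S(1) len_es by (simp add: hypertree_def)
  define cs where "cs = sorted_list_of_set C"
  have cs: "sorted_wrt (<) cs" "set cs = C" "length cs = length es" "distinct cs"
    using C(1) card_C by (simp_all add: cs_def)
  have map_cs: "distinct (map h cs)" "set (map h cs) = faces S 2" "length (map h cs) = length es"
    using cs C by (simp_all add: distinct_map)
  have mat: "Matrix.mat (length es) (length es) (\<lambda>(i, j). incidence (es ! i) (map h cs ! j)) =
      Matrix.mat (length es) (length es) (\<lambda>(i, j). (map (\<lambda>e j. incidence e (h j)) es ! i) (cs ! j))"
    using cs(3) by (intro eq_matI) auto
  have "finite (carrier (H1 R S))" using S(1) by (simp add: R hypertree_def)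
  then have "card (carrier (H1 R S)) \<le> nat \<bar>Determinant.det
      (Matrix.mat (length es) (length es) (\<lambda>(i, j). incidence (es ! i) (map h cs ! j)))\<bar>"
    by (intro card_H1_le_det es map_cs refl)
  also have "Determinant.det (Matrix.mat (length es) (length es)
      (\<lambda>(i, j). incidence (es ! i) (map h cs ! j))) = wedge (map (\<lambda>e j. incidence e (h j)) es) C"
    unfolding mat using det_eq_wedge[OF cs(1), of "map (\<lambda>e j. incidence e (h j)) es"] cs(2,3) by simp
  finally show ?thesis unfolding R C_def by simp
qed

text \<open>The left side is \<open>n ^ ((n - 2) choose 2)\<close> times the expectation of
  \<open>p ^ dim_H1_mod p S\<close> for a determinantal hypertree \<open>S\<close>.\<close>

lemma sum_hypertrees_le:
  assumes n: "n \<ge> 1" and p: "prime p" and k: "k \<ge> 1"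
  shows "(\<Sum>S\<in>{S. hypertree n S}. (real (card (carrier (H1 int_ring S))))\<^sup>2 * real p ^ dim_H1_mod p S) \<le>
    real n ^ (k + (n - 1 choose 2)) * real p ^ (k * n) * (1 + real p / real k) ^ (n - 1 choose 2)"
proof -
  define E where "E = base_edges n"
  define F where "F = E \<rightarrow>\<^sub>E {0..<int p}"
  obtain es where es: "distinct es" "set es = E"
    using finite_distinct_list[OF finite_base_edges] unfolding E_def by metis
  have "finite {\<sigma>. \<sigma> \<subseteq> {1..n} \<and> card \<sigma> = 3}" by (rule finite_subset[of _ "Pow {1..n}"]) auto
  then obtain J :: "nat set" and h where "finite J" and h: "bij_betw h J {\<sigma>. \<sigma> \<subseteq> {1..n} \<and> card \<sigma> = 3}"
    using ex_bij_betw_nat_finite by blast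
  define rows where "rows = map (\<lambda>e j. incidence e (h j)) es"
  define C where "C S = {j\<in>J. h j \<in> faces S 2}" for S
  define A where "A f = {j\<in>J. cocycle_on n p f (h j)}" for f
  define T where "T = {S. hypertree n S}"
  have finT: "finite T" unfolding T_def by (rule finite_hypertrees)
  have finF: "finite F" unfolding F_def E_def using finite_base_edges by (intro finite_PiE) auto
  have faces_C: "h ` C S = faces S 2" if "S \<in> T" for S
  proof -
    have "faces S 2 \<subseteq> {\<sigma>. \<sigma> \<subseteq> {1..n} \<and> card \<sigma> = 3}"
      using that hypertree_simplex(3) unfolding T_def faces_def by fastforce
    then have faces: "h ` J \<inter> faces S 2 = faces S 2"
      unfolding bij_betw_imp_surj_on[OF h] by (rule Int_absorb1)
    have "h ` C S = h ` J \<inter> faces S 2" by (auto simp: C_def)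
    then show ?thesis by (simp only: faces)
  qed
  have injC: "inj_on C T"
    by (rule inj_onI) (metis T_def faces_C hypertree_eqI mem_Collect_eq)
  have "(\<Sum>S\<in>T. (real (card (carrier (H1 int_ring S))))\<^sup>2 * real p ^ dim_H1_mod p S) \<le>
      (\<Sum>S\<in>T. real_of_int ((wedge rows (C S))\<^sup>2) * real (card {f\<in>F. C S \<subseteq> A f}))"
  proof (rule sum_mono)
    fix S assume S: "S \<in> T"
    then have hS: "hypertree n S" by (simp add: T_def)
    have "int (card (carrier (H1 int_ring S))) \<le> \<bar>wedge rows (C S)\<bar>"
      unfolding rows_def C_def
      by (rule card_H1_le_wedge[OF hS n es(1) es(2)[unfolded E_def] h \<open>finite J\<close>])
    then have "real (card (carrier (H1 int_ring S))) \<le> real_of_int \<bar>wedge rows (C S)\<bar>"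
      by linarith
    then have "(real (card (carrier (H1 int_ring S))))\<^sup>2 \<le> (real_of_int \<bar>wedge rows (C S)\<bar>)\<^sup>2"
      by (rule power_mono) simp
    then have 1: "(real (card (carrier (H1 int_ring S))))\<^sup>2 \<le> real_of_int ((wedge rows (C S))\<^sup>2)"
      by simp
    have "{f \<in> F. \<forall>\<sigma>\<in>faces S 2. cocycle_on n p f \<sigma>} = {f\<in>F. C S \<subseteq> A f}"
      unfolding faces_C[OF S, symmetric] by (auto simp: A_def C_def)
    then have "p ^ dim_H1_mod p S \<le> card {f\<in>F. C S \<subseteq> A f}"
      using power_dim_H1_mod_le[OF hS n p] unfolding F_def E_def by simp
    then have 2: "real p ^ dim_H1_mod p S \<le> real (card {f\<in>F. C S \<subseteq> A f})"
      by (metis of_nat_le_iff of_nat_power)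
    show "(real (card (carrier (H1 int_ring S))))\<^sup>2 * real p ^ dim_H1_mod p S \<le>
        real_of_int ((wedge rows (C S))\<^sup>2) * real (card {f\<in>F. C S \<subseteq> A f})"
      by (rule mult_mono[OF 1 2]) simp_all
  qed
  also have "\<dots> = (\<Sum>S\<in>T. \<Sum>f\<in>F. if C S \<subseteq> A f then real_of_int ((wedge rows (C S))\<^sup>2) else 0)"
    using finF by (intro sum.cong refl) (simp add: sum.If_cases Int_def mult.commute)
  \<comment> \<open>From here on the cocycle is fixed and the hypertrees inside its set of
    admissible triangles vary.\<close>
  also have "\<dots> = (\<Sum>f\<in>F. \<Sum>S\<in>T. if C S \<subseteq> A f then real_of_int ((wedge rows (C S))\<^sup>2) else 0)"
    by (rule sum.swap)
  also have "\<dots> \<le> (\<Sum>f\<in>F. \<Prod>e\<in>E. real (card {z\<in>{1..n}. forced_value n p f e z = f e}))"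
  proof (rule sum_mono)
    fix f assume f: "f \<in> F"
    have finA: "finite (A f)" unfolding A_def using \<open>finite J\<close> by simp
    have "(\<Sum>S\<in>T. if C S \<subseteq> A f then real_of_int ((wedge rows (C S))\<^sup>2) else 0) =
        (\<Sum>S\<in>{S\<in>T. C S \<subseteq> A f}. real_of_int ((wedge rows (C S))\<^sup>2))"
      by (rule sum.inter_filter[OF finT, symmetric])
    also have "\<dots> = (\<Sum>D\<in>C ` {S\<in>T. C S \<subseteq> A f}. real_of_int ((wedge rows D)\<^sup>2))"
      using sum.reindex[OF inj_on_subset[OF injC], of "{S\<in>T. C S \<subseteq> A f}"
          "\<lambda>D. real_of_int ((wedge rows D)\<^sup>2)"] by (simp add: o_def)
    \<comment> \<open>Distinct hypertrees have distinct column sets, so passing to all subsets of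
      \<open>A f\<close> only adds squares. This makes Hadamard's inequality applicable.\<close>
    also have "\<dots> \<le> (\<Sum>D\<in>Pow (A f). real_of_int ((wedge rows D)\<^sup>2))"
      using finA by (intro sum_mono2) auto
    also have "\<dots> = real_of_int (\<Sum>D\<in>Pow (A f). (wedge rows D)\<^sup>2)" by simp
    also have "\<dots> \<le> real_of_int (\<Prod>v\<leftarrow>rows. \<Sum>j\<in>A f. (v j)\<^sup>2)"
      unfolding of_int_le_iff by (rule sum_wedge_square_le[OF finA])
    also have "(\<Prod>v\<leftarrow>rows. \<Sum>j\<in>A f. (v j)\<^sup>2) = (\<Prod>e\<in>E. \<Sum>j\<in>A f. (incidence e (h j))\<^sup>2)"
      unfolding rows_def es(2)[symmetric] using es(1)
      by (simp add: prod.distinct_set_conv_list o_def)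
    also have "real_of_int \<dots> = (\<Prod>e\<in>E. real_of_int (\<Sum>j\<in>A f. (incidence e (h j))\<^sup>2))"
      by simp
    also have "\<dots> \<le> (\<Prod>e\<in>E. real (card {z\<in>{1..n}. forced_value n p f e z = f e}))"
    proof (rule prod_mono, rule conjI)
      fix e assume e: "e \<in> E"
      show "0 \<le> real_of_int (\<Sum>j\<in>A f. (incidence e (h j))\<^sup>2)" by (simp add: sum_nonneg)
      have "(\<Sum>j\<in>A f. (incidence e (h j))\<^sup>2) \<le> int (card {z\<in>{1..n}. forced_value n p f e z = f e})"
      proof (rule sum_incidence_square_le)
        show "inj_on h (A f)" using h by (auto simp: A_def bij_betw_def intro: inj_on_subset)
        show "h j \<subseteq> {1..n} \<and> cocycle_on n p f (h j)" if "j \<in> A f" for j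
          using that h by (auto simp: A_def bij_betw_def)
        show "f e \<in> {0..<int p}" using f e by (auto simp: F_def)
      qed (use e finA in \<open>auto simp: E_def\<close>)
      then show "real_of_int (\<Sum>j\<in>A f. (incidence e (h j))\<^sup>2) \<le>
          real (card {z\<in>{1..n}. forced_value n p f e z = f e})"
        by (metis of_int_le_iff of_int_of_nat_eq)
    qed
    finally show "(\<Sum>S\<in>T. if C S \<subseteq> A f then real_of_int ((wedge rows (C S))\<^sup>2) else 0) \<le>
        (\<Prod>e\<in>E. real (card {z\<in>{1..n}. forced_value n p f e z = f e}))" .
  qed
  also have "\<dots> \<le> real n ^ (k + (n - 1 choose 2)) * real p ^ (k * n) *
      (1 + real p / real k) ^ (n - 1 choose 2)"
    unfolding F_def E_def using n k prime_ge_1_nat[OF p] by (intro sum_prod_forced_value_le)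
  finally show ?thesis unfolding T_def .
qed

section \<open>Convergence in probability\<close>

lemma hypertree_tail_bound_tendsto_0:
  fixes a b c :: real
  assumes "c > 0"
  shows "(\<lambda>n. exp ((real n + a) * ln (real n) + b * real n - c * (real n)\<^sup>2)) \<longlonglongrightarrow> 0"
  using assms by real_asymp

lemma choose_two_diff:
  assumes "n \<ge> 2"
  shows "(n - 1 choose 2) = (n - 2 choose 2) + (n - 2)"
proof -
  obtain l where "n = Suc (Suc l)" using assms by (metis Suc_le_D Suc_le_mono numeral_2_eq_2)
  then show ?thesis by (simp add: numeral_2_eq_2)
qed

lemma choose_two_le: "real (n - 1 choose 2) \<le> (real n)\<^sup>2 / 2"
proof -
  have "2 * (n - 1 choose 2) \<le> n * n"
    unfolding choose_two by (rule order_trans[of _ "(n - 1) * (n - 1 - 1)"]) (auto intro: mult_le_mono)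
  then have "2 * real (n - 1 choose 2) \<le> real n * real n"
    by (metis of_nat_le_iff of_nat_mult of_nat_numeral)
  then show ?thesis by (simp add: power2_eq_square)
qed

text \<open>On the right, apart from \<open>x * ln (real p)\<close>, the only term quadratic in
  \<open>n\<close> carries the factor \<open>p / k\<close>, which a large \<open>k\<close> makes
  small.\<close>

lemma power_bound_le_exp:
  assumes n: "n \<ge> 2" and p: "p \<ge> 2" and k: "k \<ge> 1"
  shows "real n ^ (k + (n - 1 choose 2)) * real p ^ (k * n) * (1 + real p / real k) ^ (n - 1 choose 2) /
      (real n ^ (n - 2 choose 2) * real p powr x) \<le>
    exp ((real n + real k) * ln (real n) + real k * ln (real p) * real n +
      real p / real k * ((real n)\<^sup>2 / 2) - x * ln (real p))"
proof -
  define N where "N = (n - 1 choose 2)"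
  define r where "r = real p / real k"
  have r: "r > 0" using p k by (simp add: r_def)
  have pos: "real n > 0" "real p > 0" using n p by auto
  \<comment> \<open>Kalai's total cancels all but \<open>k + (n - 2)\<close> of the factors
    \<open>n\<close>, so the exponent is only of order \<open>n * ln n\<close>.\<close>
  have npow: "real n ^ (k + N) = real n ^ (k + (n - 2)) * real n ^ (n - 2 choose 2)"
    unfolding N_def choose_two_diff[OF n] by (simp add: power_add mult_ac)
  have "real n ^ (k + (n - 2)) = exp (real (k + (n - 2)) * ln (real n))"
    using pos by (simp add: exp_of_nat_mult del: of_nat_add)
  also have "\<dots> \<le> exp ((real n + real k) * ln (real n))"
    using n by (auto intro!: mult_right_mono)
  finally have 1: "real n ^ (k + (n - 2)) \<le> exp ((real n + real k) * ln (real n))" .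
  have 2: "real p ^ (k * n) = exp (real k * ln (real p) * real n)"
    using pos exp_of_nat_mult[of "k * n" "ln (real p)"] by (simp add: mult_ac)
  have "(1 + r) ^ N \<le> exp r ^ N" using r by (intro power_mono) auto
  also have "\<dots> = exp (real N * r)" by (simp add: exp_of_nat_mult)
  also have "\<dots> \<le> exp (r * ((real n)\<^sup>2 / 2))"
    using mult_left_mono[OF choose_two_le[of n], of r] r by (simp add: N_def mult.commute)
  finally have 3: "(1 + r) ^ N \<le> exp (r * ((real n)\<^sup>2 / 2))" .
  have "real n ^ (k + N) * real p ^ (k * n) * (1 + r) ^ N /
      (real n ^ (n - 2 choose 2) * real p powr x) =
      real n ^ (k + (n - 2)) * real p ^ (k * n) * (1 + r) ^ N * real p powr (- x)"
    unfolding npow using pos by (simp add: powr_minus field_simps)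
  also have "\<dots> \<le> exp ((real n + real k) * ln (real n)) * exp (real k * ln (real p) * real n) *
      exp (r * ((real n)\<^sup>2 / 2)) * exp (- x * ln (real p))"
    unfolding 2 using pos r by (intro mult_mono 1 3 mult_nonneg_nonneg) (auto simp: powr_def)
  also have "\<dots> = exp ((real n + real k) * ln (real n) + real k * ln (real p) * real n +
      r * ((real n)\<^sup>2 / 2) - x * ln (real p))"
    by (simp flip: exp_add)
  finally show ?thesis unfolding N_def r_def .
qed

text \<open>Markov's inequality for \<open>p ^ dim_H1_mod p (T \<omega>)\<close>, written out as a
  sum over the finitely many hypertrees.\<close>

lemma determinantal_hypertree_tail_le:
  assumes T: "determinantal_hypertree n M T" and n: "n \<ge> 2" and p: "prime p" and k: "k \<ge> 1"
  shows "measure M {\<omega>\<in>space M. x < real (dim_H1_mod p (T \<omega>))} \<le>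
    real n ^ (k + (n - 1 choose 2)) * real p ^ (k * n) * (1 + real p / real k) ^ (n - 1 choose 2) /
      (real n ^ (n - 2 choose 2) * real p powr x)"
proof -
  interpret prob_space M using T by (simp add: determinantal_hypertree_def)
  define H where "H = {S. hypertree n S}"
  define D where "D = {S\<in>H. x < real (dim_H1_mod p S)}"
  define w where "w S = (real (card (carrier (H1 int_ring S))))\<^sup>2" for S
  define L where "L = real n ^ (n - 2 choose 2)"
  have finH: "finite H" unfolding H_def by (rule finite_hypertrees)
  then have finD: "finite D" by (simp add: D_def)
  have meas: "T \<in> measurable M (count_space H)"
    using T by (simp add: determinantal_hypertree_def H_def)
  have prob_eq: "measure M {\<omega>\<in>space M. T \<omega> = S} = w S / L" if "S \<in> H" for S
    using T that by (simp add: determinantal_hypertree_def H_def w_def L_def)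
  have p0: "real p > 1" using prime_gt_1_nat[OF p] by simp
  have L: "L > 0" using n by (simp add: L_def)
  have event: "{\<omega>\<in>space M. T \<omega> = S} \<in> sets M" if "S \<in> H" for S
  proof -
    have "T -` {S} \<inter> space M \<in> sets M"
      using that by (intro measurable_sets[OF meas]) simp
    moreover have "T -` {S} \<inter> space M = {\<omega>\<in>space M. T \<omega> = S}" by auto
    ultimately show ?thesis by simp
  qed
  have "{\<omega>\<in>space M. x < real (dim_H1_mod p (T \<omega>))} = (\<Union>S\<in>D. {\<omega>\<in>space M. T \<omega> = S})"
    using measurable_space[OF meas] by (auto simp: D_def)
  then have "measure M {\<omega>\<in>space M. x < real (dim_H1_mod p (T \<omega>))} \<le>
      (\<Sum>S\<in>D. measure M {\<omega>\<in>space M. T \<omega> = S})"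
    using event finD by (auto simp: D_def intro!: finite_measure_subadditive_finite)
  also have "\<dots> = (\<Sum>S\<in>D. w S / L)"
    using prob_eq by (intro sum.cong) (auto simp: D_def)
  also have "\<dots> \<le> (\<Sum>S\<in>D. w S * real p ^ dim_H1_mod p S / (L * real p powr x))"
  proof (rule sum_mono)
    fix S assume "S \<in> D"
    then have "real p powr x \<le> real p powr real (dim_H1_mod p S)"
      using p0 by (intro powr_mono) (auto simp: D_def)
    also have "\<dots> = real p ^ dim_H1_mod p S" using p0 by (simp add: powr_realpow)
    finally have "w S * real p powr x \<le> w S * real p ^ dim_H1_mod p S"
      by (intro mult_left_mono) (auto simp: w_def)
    moreover have "w S / L = w S * real p powr x / (L * real p powr x)"
      using p0 by simp
    ultimately show "w S / L \<le> w S * real p ^ dim_H1_mod p S / (L * real p powr x)"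
      using L p0 by (simp only:) (intro divide_right_mono, auto)
  qed
  also have "\<dots> \<le> (\<Sum>S\<in>H. w S * real p ^ dim_H1_mod p S / (L * real p powr x))"
    using finH L by (intro sum_mono2) (auto simp: D_def w_def)
  also have "\<dots> = (\<Sum>S\<in>H. w S * real p ^ dim_H1_mod p S) / (L * real p powr x)"
    by (simp add: sum_divide_distrib)
  also have "\<dots> \<le> real n ^ (k + (n - 1 choose 2)) * real p ^ (k * n) *
      (1 + real p / real k) ^ (n - 1 choose 2) / (L * real p powr x)"
    using sum_hypertrees_le[of n p k] n p k L unfolding H_def w_def
    by (intro divide_right_mono) auto
  finally show ?thesis unfolding L_def .
qed

theorem corollary2:
  fixes p :: nat
    and M :: "nat \<Rightarrow> 'a measure"
    and T :: "nat \<Rightarrow> 'a \<Rightarrow> nat set set"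
  assumes "prime p"
    and "\<And>n. n \<ge> 3 \<Longrightarrow> determinantal_hypertree n (M n) (T n)"
  shows "converges_in_probability M (\<lambda>n \<omega>. real (dim_H1_mod p (T n \<omega>)) / (real n)\<^sup>2) 0"
  unfolding converges_in_probability_def
proof (intro allI impI)
  fix \<epsilon> :: real assume \<epsilon>: "\<epsilon> > 0"
  have p: "p \<ge> 2" using assms(1) by (rule prime_ge_2_nat)
  define c where "c = \<epsilon> * ln (real p)"
  have c: "c > 0" using \<epsilon> p by (simp add: c_def)
  \<comment> \<open>This constant gives \<open>p / k <= c\<close>. The quadratic terms of the
    exponent then add up to at most \<open>c / 2 - c = - c / 2\<close> times the square of
    \<open>n\<close>.\<close>
  define k where "k = Suc (nat \<lceil>real p / c\<rceil>)"
  have "real p / c \<le> real k" unfolding k_def by linarith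
  then have k: "k \<ge> 1" "real p / real k \<le> c"
    using c by (simp_all add: k_def divide_le_eq mult.commute del: of_nat_Suc)
  let ?f = "\<lambda>n. measure (M n) {\<omega>\<in>space (M n). \<bar>real (dim_H1_mod p (T n \<omega>)) / (real n)\<^sup>2 - 0\<bar> > \<epsilon>}"
  let ?g = "\<lambda>n. exp ((real n + real k) * ln (real n) + (real k * ln (real p)) * real n - c / 2 * (real n)\<^sup>2)"
  have le: "?f n \<le> ?g n" if n: "n \<ge> 3" for n
  proof -
    have "?f n = measure (M n) {\<omega>\<in>space (M n). \<epsilon> * (real n)\<^sup>2 < real (dim_H1_mod p (T n \<omega>))}"
      using n by (simp add: less_divide_eq)
    also have "\<dots> \<le> real n ^ (k + (n - 1 choose 2)) * real p ^ (k * n) *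
        (1 + real p / real k) ^ (n - 1 choose 2) / (real n ^ (n - 2 choose 2) * real p powr (\<epsilon> * (real n)\<^sup>2))"
      using n k(1) by (intro determinantal_hypertree_tail_le assms) auto
    also have "\<dots> \<le> exp ((real n + real k) * ln (real n) + real k * ln (real p) * real n +
        real p / real k * ((real n)\<^sup>2 / 2) - \<epsilon> * (real n)\<^sup>2 * ln (real p))"
      using n p k(1) by (intro power_bound_le_exp) auto
    also have "\<dots> \<le> ?g n"
    proof -
      have "real p / real k * ((real n)\<^sup>2 / 2) \<le> c * ((real n)\<^sup>2 / 2)"
        by (rule mult_right_mono[OF k(2)]) simp
      moreover have "\<epsilon> * (real n)\<^sup>2 * ln (real p) = c * (real n)\<^sup>2" by (simp add: c_def)
      moreover have "c * ((real n)\<^sup>2 / 2) = c / 2 * (real n)\<^sup>2"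
        "c * (real n)\<^sup>2 = c / 2 * (real n)\<^sup>2 + c / 2 * (real n)\<^sup>2" by simp_all
      ultimately show ?thesis unfolding exp_le_cancel_iff by linarith
    qed
    finally show ?thesis .
  qed
  have "?g \<longlonglongrightarrow> 0"
    using hypertree_tail_bound_tendsto_0[of "c / 2" "real k" "real k * ln (real p)"] c by simp
  then show "?f \<longlonglongrightarrow> 0"
  proof (rule tendsto_sandwich[rotated 3, where f = "\<lambda>_. 0"])
    show "eventually (\<lambda>n. ?f n \<le> ?g n) sequentially"
      using le by (auto intro: eventually_sequentiallyI[of 3])
  qed auto
qed

end
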